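(* Given a set of $m$ symmetric, positive semidefinite matrices $A_1,\dots,A_m\in\mathbb{R}^{d\times d}$, one can compute the coefficient of $x^{d-k}$ in the mixed characteristic polynomial $\mu[A_1,\dots,A_m](x)$ in $\mathrm{poly}(m^k)$ time.
   Context: For symmetric $A_1,\dots,A_m\in\mathbb{R}^{d\times d}$, the mixed characteristic polynomial is $$\mu[A_1,\dots,A_m](x)=\prod_{i=1}^m\Big(1-\frac{\partial}{\partial z_i}\Big)\det\Big(xI+\sum_{i=1}^m z_iA_i\Big)\Big|_{z_1=\dots=z_m=0},$$ where $I$ is the $d\times d$ identity matrix. $\mathrm{poly}(m^k)$ denotes a bound that is polynomial in $m^k$.
   Formalization: Time is unit-cost exact real arithmetic, and the bound proved is poly(m^k)·poly(d): a bound in m^k alone fails, since for m = k = 1 the coefficient is −tr(A), which requires reading d entries. *)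

theory Defs
  imports "HOL-Analysis.Derivative" "Jordan_Normal_Form.Determinant"
begin

section \<open>The mixed characteristic polynomial\<close>

definition psd_mat :: "nat \<Rightarrow> real mat \<Rightarrow> bool" where
  "psd_mat d A \<longleftrightarrow> A \<in> carrier_mat d d \<and> transpose_mat A = A \<and>
     (\<forall>v \<in> carrier_vec d. 0 \<le> scalar_prod v (A *\<^sub>v v))"

definition partial_deriv :: "nat \<Rightarrow> ((nat \<Rightarrow> real) \<Rightarrow> real) \<Rightarrow> (nat \<Rightarrow> real) \<Rightarrow> real" where
  "partial_deriv i f z = deriv (\<lambda>t. f (z(i := t))) (z i)"

definition one_minus_partial :: "nat \<Rightarrow> ((nat \<Rightarrow> real) \<Rightarrow> real) \<Rightarrow> (nat \<Rightarrow> real) \<Rightarrow> real" where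
  "one_minus_partial i f = (\<lambda>z. f z - partial_deriv i f z)"

text \<open>The determinant of \<open>x I + z\<^sub>0 A\<^sub>0 + \<dots> + z\<^sub>m\<^sub>-\<^sub>1 A\<^sub>m\<^sub>-\<^sub>1\<close>; matrices are indexed from 0.\<close>

definition pencil_det :: "nat \<Rightarrow> nat \<Rightarrow> (nat \<Rightarrow> real mat) \<Rightarrow> real \<Rightarrow> (nat \<Rightarrow> real) \<Rightarrow> real" where
  "pencil_det d m A x z =
     det (mat d d (\<lambda>rc. x * 1\<^sub>m d $$ rc + (\<Sum>i<m. z i * A i $$ rc)))"

definition mixed_char_fun :: "nat \<Rightarrow> nat \<Rightarrow> (nat \<Rightarrow> real mat) \<Rightarrow> real \<Rightarrow> real" where
  "mixed_char_fun d m A x = foldr one_minus_partial [0..<m] (pencil_det d m A x) (\<lambda>_. 0)"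

text \<open>The polynomial in \<open>x\<close> inducing this function; \<open>poly_mixed_charpoly\<close> below shows that
  it exists, so the description is never vacuous.\<close>

definition mixed_charpoly :: "nat \<Rightarrow> nat \<Rightarrow> (nat \<Rightarrow> real mat) \<Rightarrow> real poly" where
  "mixed_charpoly d m A = (THE p. \<forall>x. poly p x = mixed_char_fun d m A x)"

inductive poly_fun :: "(real \<Rightarrow> (nat \<Rightarrow> real) \<Rightarrow> real) \<Rightarrow> bool" where
  const: "poly_fun (\<lambda>x z. c)"
| X: "poly_fun (\<lambda>x z. x)"
| Z: "poly_fun (\<lambda>x z. z i)"
| add: "poly_fun f \<Longrightarrow> poly_fun g \<Longrightarrow> poly_fun (\<lambda>x z. f x z + g x z)"
| mult: "poly_fun f \<Longrightarrow> poly_fun g \<Longrightarrow> poly_fun (\<lambda>x z. f x z * g x z)"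

lemma poly_fun_sum:
  "(\<And>a. a \<in> S \<Longrightarrow> poly_fun (f a)) \<Longrightarrow> poly_fun (\<lambda>x z. \<Sum>a\<in>S. f a x z)"
  by (induction S rule: infinite_finite_induct) (auto intro: poly_fun.intros)

lemma poly_fun_prod:
  "(\<And>a. a \<in> S \<Longrightarrow> poly_fun (f a)) \<Longrightarrow> poly_fun (\<lambda>x z. \<Prod>a\<in>S. f a x z)"
  by (induction S rule: infinite_finite_induct) (auto intro: poly_fun.intros)

lemma poly_fun_has_partial:
  assumes "poly_fun f"
  shows "\<exists>g. poly_fun g \<and>
    (\<forall>x z. ((\<lambda>t. f x (z(i := t))) has_field_derivative g x z) (at (z i)))"
  using assms
proof induction
  case (const c)
  show ?case by (rule exI[of _ "\<lambda>x z. 0"]) (auto intro: poly_fun.const)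
next
  case X
  show ?case by (rule exI[of _ "\<lambda>x z. 0"]) (auto intro: poly_fun.const)
next
  case (Z j)
  show ?case
    by (rule exI[of _ "\<lambda>x z. if j = i then 1 else 0"]) (auto intro: poly_fun.const)
next
  case (add f g)
  then obtain f' g' where *: "poly_fun f'" "poly_fun g'"
    and f': "\<And>x z. ((\<lambda>t. f x (z(i := t))) has_field_derivative f' x z) (at (z i))"
    and g': "\<And>x z. ((\<lambda>t. g x (z(i := t))) has_field_derivative g' x z) (at (z i))"
    by blast
  have "((\<lambda>t. f x (z(i := t)) + g x (z(i := t))) has_field_derivative
      f' x z + g' x z) (at (z i))" for x z
    by (rule DERIV_add[OF f' g'])
  moreover have "poly_fun (\<lambda>x z. f' x z + g' x z)"
    using * by (rule poly_fun.add)
  ultimately show ?case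
    by (intro exI[of _ "\<lambda>x z. f' x z + g' x z"] conjI allI)
next
  case (mult f g)
  then obtain f' g' where *: "poly_fun f'" "poly_fun g'"
    and f': "\<And>x z. ((\<lambda>t. f x (z(i := t))) has_field_derivative f' x z) (at (z i))"
    and g': "\<And>x z. ((\<lambda>t. g x (z(i := t))) has_field_derivative g' x z) (at (z i))"
    by blast
  have "((\<lambda>t. f x (z(i := t)) * g x (z(i := t))) has_field_derivative
      f x z * g' x z + f' x z * g x z) (at (z i))" for x z
    using DERIV_mult'[OF f'[of x z] g'[of x z]] by simp
  moreover have "poly_fun (\<lambda>x z. f x z * g' x z + f' x z * g x z)"
    using mult.hyps * by (intro poly_fun.intros)
  ultimately show ?case
    by (intro exI[of _ "\<lambda>x z. f x z * g' x z + f' x z * g x z"] conjI allI)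
qed

lemma poly_fun_one_minus_partial:
  assumes "poly_fun f"
  shows "poly_fun (\<lambda>x. one_minus_partial i (f x))"
proof -
  obtain g where g: "poly_fun g"
    "\<And>x z. ((\<lambda>t. f x (z(i := t))) has_field_derivative g x z) (at (z i))"
    using poly_fun_has_partial[OF assms, of i] by blast
  have "(\<lambda>x. one_minus_partial i (f x)) = (\<lambda>x z. f x z + (- 1) * g x z)"
    by (intro ext) (simp add: one_minus_partial_def partial_deriv_def DERIV_imp_deriv[OF g(2)])
  moreover have "poly_fun \<dots>"
    using assms g(1) by (intro poly_fun.intros)
  ultimately show ?thesis by (simp only:)
qed

lemma poly_fun_pencil_det: "poly_fun (pencil_det d m A)"
proof -
  have less: "p r < d" if "p permutes {0..<d}" "r < d" for p r
    using permutes_in_image[OF that(1), of r] that(2) by simp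
  have "pencil_det d m A = (\<lambda>x z. \<Sum>p | p permutes {0..<d}. signof p *
      (\<Prod>r = 0..<d. x * (if r = p r then 1 else 0) + (\<Sum>i<m. z i * A i $$ (r, p r))))"
    unfolding pencil_det_def
    by (intro ext, subst det_def'[of _ d]) (auto intro!: sum.cong prod.cong simp: less)
  moreover have "poly_fun \<dots>"
    by (intro poly_fun_sum poly_fun_prod poly_fun.intros)
  ultimately show ?thesis by simp
qed

lemma poly_fun_eval:
  assumes "poly_fun f"
  shows "\<exists>p. \<forall>x. poly p x = f x z"
  using assms
proof induction
  case (const c)
  show ?case by (rule exI[of _ "[:c:]"]) simp
next
  case X
  show ?case by (rule exI[of _ "[:0, 1:]"]) simp
next
  case (Z i)
  show ?case by (rule exI[of _ "[:z i:]"]) simp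
next
  case (add f g)
  then obtain p q where "\<And>x. poly p x = f x z" "\<And>x. poly q x = g x z" by blast
  then show ?case by (intro exI[of _ "p + q"]) simp
next
  case (mult f g)
  then obtain p q where "\<And>x. poly p x = f x z" "\<And>x. poly q x = g x z" by blast
  then show ?case by (intro exI[of _ "p * q"]) simp
qed

lemma poly_mixed_charpoly: "poly (mixed_charpoly d m A) x = mixed_char_fun d m A x"
proof -
  have "poly_fun (\<lambda>x. foldr one_minus_partial is (pencil_det d m A x))" for "is"
    by (induction "is") (auto intro: poly_fun_pencil_det poly_fun_one_minus_partial)
  from poly_fun_eval[OF this]
  obtain p where p: "\<And>x. poly p x = mixed_char_fun d m A x"
    unfolding mixed_char_fun_def by blast
  have "q = p" if "\<forall>x. poly q x = mixed_char_fun d m A x" for q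
    using that p by (intro poly_eq_poly_eq_iff[THEN iffD1] ext) simp
  then have "\<forall>x. poly (mixed_charpoly d m A) x = mixed_char_fun d m A x"
    unfolding mixed_charpoly_def
    by (rule theI[of "\<lambda>q. \<forall>x. poly q x = mixed_char_fun d m A x" p, rotated])
      (simp_all add: p)
  then show ?thesis ..
qed

section \<open>A real random access machine\<close>

text \<open>The inputs are real matrices, so running time is measured in the real RAM (BSS) model:
  unbounded index and real memories with indirect addressing, exact real arithmetic and
  comparison at unit cost, and structured control flow. There is no rounding from real numbers
  to indices. Indices can only be added and subtracted, so that \<open>t\<close>
  steps lengthen an index by \<open>O(t)\<close> bits only and unit cost is no more powerful than charging for index length.
  Real constants in programs are integers; arbitrary real constants could smuggle in advice.\<close>

datatype iexp =
    IConst nat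
  | IMem iexp
  | IAdd iexp iexp
  | ISub iexp iexp

datatype rexp =
    RConst int
  | RMem iexp
  | RAdd rexp rexp
  | RSub rexp rexp
  | RMul rexp rexp
  | RDiv rexp rexp

datatype test = ILess iexp iexp | RLess rexp rexp

datatype prog =
    Skip
  | ISet iexp iexp \<comment> \<open>address, value\<close>
  | RSet iexp rexp \<comment> \<open>address, value\<close>
  | Seq prog prog
  | If test prog prog
  | While test prog

type_synonym mem = "(nat \<Rightarrow> nat) \<times> (nat \<Rightarrow> real)"

text \<open>Subtraction of indices is truncated and division by zero yields zero.\<close>

primrec ival :: "iexp \<Rightarrow> mem \<Rightarrow> nat" where
  "ival (IConst n) s = n"
| "ival (IMem a) s = fst s (ival a s)"
| "ival (IAdd a b) s = ival a s + ival b s"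
| "ival (ISub a b) s = ival a s - ival b s"

primrec rval :: "rexp \<Rightarrow> mem \<Rightarrow> real" where
  "rval (RConst c) s = of_int c"
| "rval (RMem a) s = snd s (ival a s)"
| "rval (RAdd a b) s = rval a s + rval b s"
| "rval (RSub a b) s = rval a s - rval b s"
| "rval (RMul a b) s = rval a s * rval b s"
| "rval (RDiv a b) s = rval a s / rval b s"

primrec holds :: "test \<Rightarrow> mem \<Rightarrow> bool" where
  "holds (ILess a b) s \<longleftrightarrow> ival a s < ival b s"
| "holds (RLess a b) s \<longleftrightarrow> rval a s < rval b s"

primrec icost :: "iexp \<Rightarrow> nat" where
  "icost (IConst n) = 1"
| "icost (IMem a) = icost a + 1"
| "icost (IAdd a b) = icost a + icost b + 1"
| "icost (ISub a b) = icost a + icost b + 1"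

primrec rcost :: "rexp \<Rightarrow> nat" where
  "rcost (RConst c) = 1"
| "rcost (RMem a) = icost a + 1"
| "rcost (RAdd a b) = rcost a + rcost b + 1"
| "rcost (RSub a b) = rcost a + rcost b + 1"
| "rcost (RMul a b) = rcost a + rcost b + 1"
| "rcost (RDiv a b) = rcost a + rcost b + 1"

primrec tcost :: "test \<Rightarrow> nat" where
  "tcost (ILess a b) = icost a + icost b + 1"
| "tcost (RLess a b) = rcost a + rcost b + 1"

text \<open>\<open>runs P s t s'\<close>: started in \<open>s\<close>, program \<open>P\<close> halts in \<open>s'\<close> after \<open>t\<close> steps.\<close>

inductive runs :: "prog \<Rightarrow> mem \<Rightarrow> nat \<Rightarrow> mem \<Rightarrow> bool" where
  Skip: "runs Skip s 1 s"
| ISet: "runs (ISet a e) s (icost a + icost e + 1) ((fst s)(ival a s := ival e s), snd s)"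
| RSet: "runs (RSet a e) s (icost a + rcost e + 1) (fst s, (snd s)(ival a s := rval e s))"
| Seq: "runs P s t s' \<Longrightarrow> runs Q s' u s'' \<Longrightarrow> runs (Seq P Q) s (t + u) s''"
| IfTrue: "holds b s \<Longrightarrow> runs P s t s' \<Longrightarrow> runs (If b P Q) s (tcost b + t) s'"
| IfFalse: "\<not> holds b s \<Longrightarrow> runs Q s t s' \<Longrightarrow> runs (If b P Q) s (tcost b + t) s'"
| WhileFalse: "\<not> holds b s \<Longrightarrow> runs (While b P) s (tcost b) s"
| WhileTrue: "holds b s \<Longrightarrow> runs P s t s' \<Longrightarrow> runs (While b P) s' u s'' \<Longrightarrow>
    runs (While b P) s (tcost b + t + u) s''"

inductive_cases runs_elims:
  "runs Skip s t s'"
  "runs (ISet a e) s t s'"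
  "runs (RSet a e) s t s'"
  "runs (Seq P Q) s t s'"
  "runs (If b P Q) s t s'"
  "runs (While b P) s t s'"

lemma runs_deterministic:
  "runs P s t s' \<Longrightarrow> runs P s u s'' \<Longrightarrow> u = t \<and> s'' = s'"
proof (induction arbitrary: u s'' rule: runs.induct)
  case (Skip s)
  then show ?case by (rule runs_elims(1)) simp
next
  case (ISet a e s)
  then show ?case by (rule runs_elims(2)) simp
next
  case (RSet a e s)
  then show ?case by (rule runs_elims(3)) simp
next
  case (Seq P s t s1 Q v s2)
  from Seq.prems obtain t' r v' where
    "runs P s t' r" "runs Q r v' s''" "u = t' + v'"
    by (rule runs_elims(4)) simp
  with Seq.IH(1)[of t' r] Seq.IH(2)[of v' s''] show ?case by simp
next
  case (IfTrue b s P t s1 Q)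
  from IfTrue.prems obtain t' where "runs P s t' s''" "u = tcost b + t'"
    by (rule runs_elims(5)) (use IfTrue.hyps in simp_all)
  with IfTrue.IH[of t' s''] show ?case by simp
next
  case (IfFalse b s Q t s1 P)
  from IfFalse.prems obtain t' where "runs Q s t' s''" "u = tcost b + t'"
    by (rule runs_elims(5)) (use IfFalse.hyps in simp_all)
  with IfFalse.IH[of t' s''] show ?case by simp
next
  case (WhileFalse b s P)
  from WhileFalse.prems show ?case
    by (rule runs_elims(6)) (use WhileFalse.hyps in simp_all)
next
  case (WhileTrue b s P t s1 v s2)
  from WhileTrue.prems obtain t' r v' where
    "runs P s t' r" "runs (While b P) r v' s''" "u = tcost b + t' + v'"
    by (rule runs_elims(6)) (use WhileTrue.hyps in simp_all)
  with WhileTrue.IH(1)[of t' r] WhileTrue.IH(2)[of v' s''] show ?case by simp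
qed

text \<open>Index cells 0, 1, 2 hold \<open>d\<close>, \<open>m\<close>, \<open>k\<close>; the real memory holds the matrices one after
  another, each in row-major order. All other cells are zero. The output is real cell 0.\<close>

definition input_mem :: "nat \<Rightarrow> nat \<Rightarrow> nat \<Rightarrow> (nat \<Rightarrow> real mat) \<Rightarrow> mem" where
  "input_mem d m k A =
     ((\<lambda>_. 0)(0 := d, 1 := m, 2 := k),
      \<lambda>a. if a < m * (d * d) then A (a div (d * d)) $$ (a mod (d * d) div d, a mod d) else 0)"

definition machine_output :: "mem \<Rightarrow> real" where
  "machine_output s = snd s 0"

end

theory Submission
  imports Defs "Jordan_Normal_Form.Char_Poly"
begin

text \<open>The coefficient of \<open>x\<^sup>d\<^sup>-\<^sup>k\<close> in \<open>det (x I + \<Sum> z\<^sub>i A\<^sub>i)\<close> is a homogeneous polynomial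
  of degree \<open>k\<close> in \<open>z\<close>, and applying \<open>\<Prod> (1 - \<partial>\<^sub>i)\<close> at \<open>z = 0\<close> extracts \<open>(-1)\<^sup>k\<close> times the sum of
  the coefficients of its squarefree monomials. By inclusion-exclusion (polarization) the
  coefficient of the monomial with support \<open>S\<close> is an alternating sum of the values at the indicator
  vectors of the subsets \<open>R\<close> of \<open>S\<close>. Each of these values is a coefficient of the characteristic
  polynomial of \<open>- (\<Sum>i\<in>R. A\<^sub>i)\<close>, which the Faddeev-LeVerrier recursion computes in time
  polynomial in \<open>d\<close>. If \<open>k \<le> m\<close>, the pairs \<open>R \<subseteq> S\<close> with \<open>|S| = k\<close> are found among
  \<open>(2 m)\<^sup>k \<le> 2 (m\<^sup>k)\<^sup>2\<close> codes; if \<open>m < k\<close>, the coefficient is zero.\<close>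

section \<open>Characteristic polynomials by the Faddeev-LeVerrier recursion\<close>

text \<open>The matrices of the recursion are the coefficients of the adjugate of \<open>x - M\<close>, by descending
  powers of \<open>x\<close>.\<close>

fun fl_mat :: "nat \<Rightarrow> (nat \<Rightarrow> nat \<Rightarrow> real) \<Rightarrow> nat \<Rightarrow> nat \<Rightarrow> nat \<Rightarrow> real" where
  "fl_mat d M 0 r c = (if r = c then 1 else 0)"
| "fl_mat d M (Suc j) r c = (\<Sum>l<d. M r l * fl_mat d M j l c) +
     (if r = c then - (\<Sum>i<d. \<Sum>l<d. M i l * fl_mat d M j l i) / real (Suc j) else 0)"

fun fl_coeff :: "nat \<Rightarrow> (nat \<Rightarrow> nat \<Rightarrow> real) \<Rightarrow> nat \<Rightarrow> real" where
  "fl_coeff d M 0 = 1"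
| "fl_coeff d M (Suc j) = - (\<Sum>i<d. \<Sum>l<d. M i l * fl_mat d M j l i) / real (Suc j)"

definition to_mat :: "nat \<Rightarrow> (nat \<Rightarrow> nat \<Rightarrow> 'a) \<Rightarrow> 'a mat" where
  "to_mat d M = mat d d (\<lambda>(r, c). M r c)"

lemma to_mat_carrier [simp]: "to_mat d M \<in> carrier_mat d d"
  by (simp add: to_mat_def)

lemma to_mat_index [simp]: "r < d \<Longrightarrow> c < d \<Longrightarrow> to_mat d M $$ (r, c) = M r c"
  by (simp add: to_mat_def)

lemma dim_to_mat [simp]: "dim_row (to_mat d M) = d" "dim_col (to_mat d M) = d"
  by (simp_all add: to_mat_def)

lemma dim_char_poly_matrix [simp]:
  "dim_row (char_poly_matrix A) = dim_row A" "dim_col (char_poly_matrix A) = dim_col A"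
  by (simp_all add: char_poly_matrix_def)

lemma char_poly_matrix_index:
  assumes "A \<in> carrier_mat d d" "r < d" "c < d"
  shows "char_poly_matrix A $$ (r, c) = [:- A $$ (r, c), if r = c then 1 else 0:]"
  using assms by (auto simp: char_poly_matrix_def)

lemma char_poly_matrix_mat_delete:
  assumes "A \<in> carrier_mat d d" "i < d"
  shows "char_poly_matrix (mat_delete A i i) = mat_delete (char_poly_matrix A) i i"
  using assms by (intro eq_matI) (auto simp: char_poly_matrix_def mat_delete_def)

lemma degree_adj_char_poly_matrix:
  assumes A: "A \<in> carrier_mat d d" and "r < d" "c < d"
  shows "degree (adj_mat (char_poly_matrix A) $$ (r, c)) \<le> d - 1"
proof -
  let ?B = "mat_delete (char_poly_matrix A) c r"
  have "?B \<in> carrier_mat (d - 1) (d - 1)"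
    using mat_delete_carrier[OF char_poly_matrix_closed[OF A], of c r] by simp
  moreover have "degree (?B $$ (i, j)) \<le> 1" if "i < d - 1" "j < d - 1" for i j
    using that A by (auto simp: mat_delete_def char_poly_matrix_index split: if_splits)
  ultimately have "degree (det ?B) \<le> 1 * (d - 1)"
    by (intro degree_det_le) auto
  moreover have "degree ((-1) ^ (c + r) * det ?B) = degree (det ?B)"
    by (cases "even (c + r)") auto
  ultimately show ?thesis
    using assms char_poly_matrix_closed[OF A] by (simp add: adj_mat_def cofactor_def)
qed

lemma char_poly_matrix_times_adj:
  fixes M :: "nat \<Rightarrow> nat \<Rightarrow> real"
  assumes r: "r < d" and c: "c < d"
  defines "B \<equiv> adj_mat (char_poly_matrix (to_mat d M))"
  shows "pCons 0 (B $$ (r, c)) = (\<Sum>l<d. smult (M r l) (B $$ (l, c))) +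
    (if r = c then char_poly (to_mat d M) else 0)"
proof -
  let ?C = "char_poly_matrix (to_mat d M)"
  have C: "?C \<in> carrier_mat d d" by simp
  have B: "B \<in> carrier_mat d d" and CB: "?C * B = char_poly (to_mat d M) \<cdot>\<^sub>m 1\<^sub>m d"
    using adj_mat[OF C] by (simp_all add: B_def char_poly_def)
  have "(if r = c then char_poly (to_mat d M) else 0) = (?C * B) $$ (r, c)"
    using r c by (simp add: CB)
  also have "\<dots> = (\<Sum>l<d. ?C $$ (r, l) * B $$ (l, c))"
    using B C r c by (auto simp: scalar_prod_def atLeast0LessThan simp del: char_poly_matrix_closed)
  also have "\<dots> = (\<Sum>l<d. (if r = l then pCons 0 (B $$ (l, c)) else 0) - smult (M r l) (B $$ (l, c)))"
    using r by (intro sum.cong refl) (auto simp: char_poly_matrix_index[of _ d])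
  also have "\<dots> = pCons 0 (B $$ (r, c)) - (\<Sum>l<d. smult (M r l) (B $$ (l, c)))"
    using r by (simp add: sum_subtractf)
  finally show ?thesis by simp
qed

lemma trace_adj_char_poly_matrix:
  assumes A: "(A :: real mat) \<in> carrier_mat d d"
  shows "(\<Sum>i<d. adj_mat (char_poly_matrix A) $$ (i, i)) = pderiv (char_poly A)"
proof -
  have "adj_mat (char_poly_matrix A) $$ (i, i) = char_poly (mat_delete A i i)" if "i < d" for i
    using that A char_poly_matrix_closed[OF A]
    by (simp add: adj_mat_def cofactor_def char_poly_def char_poly_matrix_mat_delete[OF A])
  then show ?thesis unfolding pderiv_char_poly[OF A] by (intro sum.cong) auto
qed

theorem fl_coeff_correct:
  assumes "k \<le> d"
  shows "fl_coeff d M k = coeff (char_poly (to_mat d M)) (d - k)"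
proof -
  define p where "p = char_poly (to_mat d M)"
  define B where "B = adj_mat (char_poly_matrix (to_mat d M))"
  have p_top: "coeff p d = 1"
    using degree_monic_char_poly[of "to_mat d M" d] by (simp add: p_def)
  note eq = char_poly_matrix_times_adj[of _ d _ M, folded B_def p_def]
  have rec: "coeff (B $$ (r, c)) n = (\<Sum>l<d. M r l * coeff (B $$ (l, c)) (Suc n)) +
      (if r = c then coeff p (Suc n) else 0)" if "r < d" "c < d" for r c n
    using arg_cong[OF eq[OF that], of "\<lambda>q. coeff q (Suc n)"] by (simp add: coeff_sum)
  have rec0: "(\<Sum>l<d. M i l * coeff (B $$ (l, i)) 0) = - coeff p 0" if "i < d" for i
    using arg_cong[OF eq[OF that that], of "\<lambda>q. coeff q 0"] by (simp add: coeff_sum)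
  have B_top: "coeff (B $$ (r, c)) d = 0" if "r < d" "c < d" for r c
    using degree_adj_char_poly_matrix[of "to_mat d M" d r c] that
    by (intro coeff_eq_0) (auto simp: B_def)
  have trace: "- (\<Sum>i<d. \<Sum>l<d. M i l * coeff (B $$ (l, i)) (d - Suc j)) / real (Suc j)
      = coeff p (d - Suc j)" if j: "Suc j \<le> d" for j
  proof (cases "d - Suc j")
    case 0
    with j have "real d = real (Suc j)" by simp
    then show ?thesis unfolding 0 by (simp add: rec0 field_simps)
  next
    case (Suc n)
    have "(\<Sum>i<d. coeff (B $$ (i, i)) n) = real (Suc n) * coeff p (Suc n)"
      using arg_cong[OF trace_adj_char_poly_matrix[of "to_mat d M" d], of "\<lambda>q. coeff q n"]
      by (simp add: coeff_sum coeff_pderiv B_def p_def)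
    also have "(\<Sum>i<d. coeff (B $$ (i, i)) n) =
        (\<Sum>i<d. \<Sum>l<d. M i l * coeff (B $$ (l, i)) (Suc n)) + real d * coeff p (Suc n)"
      by (simp add: rec sum.distrib)
    also have "real d = real (Suc n) + real (Suc j)" using Suc j by simp
    finally show ?thesis unfolding Suc by (simp add: field_simps)
  qed
  have fl_mat: "fl_mat d M j r c = coeff (B $$ (r, c)) (d - Suc j)"
    if "Suc j \<le> d" "r < d" "c < d" for j r c
    using that
  proof (induction j arbitrary: r c)
    case 0
    then have "Suc (d - Suc 0) = d" by simp
    with 0 show ?case by (simp add: rec[of r c "d - Suc 0"] B_top p_top)
  next
    case (Suc j)
    then have *: "d - Suc j = Suc (d - Suc (Suc j))" by simp
    have "fl_mat d M (Suc j) r c = (\<Sum>l<d. M r l * coeff (B $$ (l, c)) (d - Suc j)) +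
        (if r = c then - (\<Sum>i<d. \<Sum>l<d. M i l * coeff (B $$ (l, i)) (d - Suc j)) / real (Suc j)
         else 0)"
      using Suc by simp
    also have "\<dots> = coeff (B $$ (r, c)) (d - Suc (Suc j))"
      using Suc.prems rec[of r c "d - Suc (Suc j)"] by (subst trace) (auto simp: *)
    finally show ?case .
  qed
  show ?thesis
  proof (cases k)
    case 0
    then show ?thesis using p_top by (simp add: p_def)
  next
    case (Suc j)
    with assms have "fl_coeff d M k =
        - (\<Sum>i<d. \<Sum>l<d. M i l * coeff (B $$ (l, i)) (d - Suc j)) / real (Suc j)"
      by (simp add: fl_mat)
    also have "\<dots> = coeff p (d - Suc j)" using assms Suc by (intro trace) simp
    finally show ?thesis by (simp add: Suc p_def)
  qed
qed

section \<open>Mixed characteristic polynomials as alternating sums\<close>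

abbreviation monom_fun :: "nat list \<Rightarrow> (nat \<Rightarrow> real) \<Rightarrow> real" where
  "monom_fun w z \<equiv> (\<Prod>i\<leftarrow>w. z i)"

inductive homogeneous :: "nat \<Rightarrow> nat \<Rightarrow> ((nat \<Rightarrow> real) \<Rightarrow> real) \<Rightarrow> bool" for m j where
  zero: "homogeneous m j (\<lambda>z. 0)"
| add_monom: "homogeneous m j f \<Longrightarrow> length w = j \<Longrightarrow> set w \<subseteq> {..<m} \<Longrightarrow>
    homogeneous m j (\<lambda>z. f z + c * monom_fun w z)"

lemma homogeneous_monom:
  "length w = j \<Longrightarrow> set w \<subseteq> {..<m} \<Longrightarrow> homogeneous m j (\<lambda>z. c * monom_fun w z)"
  using homogeneous.add_monom[OF homogeneous.zero, of w j m c] by simp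

lemma homogeneous_const: "homogeneous m 0 (\<lambda>z. c)"
  using homogeneous_monom[of "[]" 0 m c] by simp

lemma homogeneous_add:
  assumes "homogeneous m j f" "homogeneous m j g"
  shows "homogeneous m j (\<lambda>z. f z + g z)"
  using assms(2)
proof induction
  case zero
  then show ?case using assms(1) by simp
next
  case (add_monom g w c)
  from homogeneous.add_monom[OF add_monom.IH add_monom.hyps(2,3), of c]
  show ?case by (simp add: add.assoc)
qed

lemma homogeneous_sum:
  "(\<And>a. a \<in> S \<Longrightarrow> homogeneous m j (f a)) \<Longrightarrow> homogeneous m j (\<lambda>z. \<Sum>a\<in>S. f a z)"
  by (induction S rule: infinite_finite_induct) (auto intro: homogeneous.zero homogeneous_add)

lemma homogeneous_linear: "homogeneous m (Suc 0) (\<lambda>z. \<Sum>i<m. z i * a i)"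
proof (rule homogeneous_sum)
  fix i assume "i \<in> {..<m}"
  then show "homogeneous m (Suc 0) (\<lambda>z. z i * a i)"
    using homogeneous_monom[of "[i]" "Suc 0" m "a i"] by (simp add: mult.commute)
qed

lemma homogeneous_mult_monom:
  assumes "homogeneous m j f" "length w = j'" "set w \<subseteq> {..<m}"
  shows "homogeneous m (j + j') (\<lambda>z. f z * (c * monom_fun w z))"
  using assms(1)
proof induction
  case zero
  then show ?case by (simp add: homogeneous.zero)
next
  case (add_monom f v b)
  have "homogeneous m (j + j') (\<lambda>z. f z * (c * monom_fun w z) + (b * c) * monom_fun (v @ w) z)"
    using add_monom assms by (intro homogeneous.add_monom) auto
  then show ?case by (simp add: algebra_simps)
qed

lemma homogeneous_mult:
  assumes f: "homogeneous m j f" and "homogeneous m j' g"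
  shows "homogeneous m (j + j') (\<lambda>z. f z * g z)"
  using assms(2)
proof induction
  case zero
  then show ?case by (simp add: homogeneous.zero)
next
  case (add_monom g w c)
  show ?case
    using homogeneous_add[OF add_monom.IH homogeneous_mult_monom[OF f add_monom.hyps(2,3), of c]]
    by (simp add: distrib_left)
qed

lemma homogeneous_imp_poly_fun: "homogeneous m j f \<Longrightarrow> poly_fun (\<lambda>x. f)"
proof (induction rule: homogeneous.induct)
  case zero
  show ?case by (rule poly_fun.const)
next
  case (add_monom f w c)
  have "poly_fun (\<lambda>x. monom_fun w)"
    by (induction w) (auto intro: poly_fun.intros)
  with add_monom show ?case by (intro poly_fun.intros)
qed

definition hom_poly :: "nat \<Rightarrow> nat \<Rightarrow> ((nat \<Rightarrow> real) \<Rightarrow> real poly) \<Rightarrow> bool" where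
  "hom_poly m n G \<longleftrightarrow>
     (\<forall>i\<le>n. homogeneous m (n - i) (\<lambda>z. coeff (G z) i)) \<and> (\<forall>i>n. \<forall>z. coeff (G z) i = 0)"

lemma hom_poly_mult:
  assumes "hom_poly m n G" "hom_poly m n' H"
  shows "hom_poly m (n + n') (\<lambda>z. G z * H z)"
  unfolding hom_poly_def
proof (intro conjI allI impI)
  fix i assume i: "i \<le> n + n'"
  have "homogeneous m (n + n' - i) (\<lambda>z. \<Sum>a\<le>i. coeff (G z) a * coeff (H z) (i - a))"
  proof (rule homogeneous_sum)
    fix a assume a: "a \<in> {..i}"
    show "homogeneous m (n + n' - i) (\<lambda>z. coeff (G z) a * coeff (H z) (i - a))"
    proof (cases "a \<le> n \<and> i - a \<le> n'")
      case True
      then have "homogeneous m ((n - a) + (n' - (i - a))) (\<lambda>z. coeff (G z) a * coeff (H z) (i - a))"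
        using assms by (intro homogeneous_mult) (auto simp: hom_poly_def)
      moreover have "(n - a) + (n' - (i - a)) = n + n' - i"
        using True a by auto
      ultimately show ?thesis by simp
    next
      case False
      then have "(\<lambda>z. coeff (G z) a * coeff (H z) (i - a)) = (\<lambda>z. 0)"
        using assms by (auto simp: hom_poly_def not_le)
      then show ?thesis by (simp add: homogeneous.zero)
    qed
  qed
  then show "homogeneous m (n + n' - i) (\<lambda>z. coeff (G z * H z) i)"
    by (simp add: coeff_mult)
next
  fix i z assume i: "n + n' < i"
  have "coeff (G z) a * coeff (H z) (i - a) = 0" if "a \<le> i" for a
  proof (cases "n < a")
    case False
    with i that have "n' < i - a" by simp
    then show ?thesis using assms(2) by (simp add: hom_poly_def)
  qed (use assms(1) in \<open>simp add: hom_poly_def\<close>)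
  then show "coeff (G z * H z) i = 0" unfolding coeff_mult by (intro sum.neutral) auto
qed

lemma hom_poly_const: "hom_poly m 0 (\<lambda>z. [:c:])"
  by (auto simp: hom_poly_def coeff_pCons homogeneous_const split: nat.split)

lemma hom_poly_prod:
  "finite S \<Longrightarrow> (\<And>a. a \<in> S \<Longrightarrow> hom_poly m 1 (G a)) \<Longrightarrow> hom_poly m (card S) (\<lambda>z. \<Prod>a\<in>S. G a z)"
proof (induction S rule: finite_induct)
  case empty
  show ?case using hom_poly_const[of m 1] by (simp add: one_pCons)
next
  case (insert x F)
  then show ?case using hom_poly_mult[of m 1 "G x" "card F" "\<lambda>z. \<Prod>a\<in>F. G a z"] by simp
qed

lemma hom_poly_sum:
  "(\<And>a. a \<in> S \<Longrightarrow> hom_poly m n (G a)) \<Longrightarrow> hom_poly m n (\<lambda>z. \<Sum>a\<in>S. G a z)"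
  by (auto simp: hom_poly_def coeff_sum intro: homogeneous_sum)

lemma hom_poly_linear: "hom_poly m 1 (\<lambda>z. [:\<Sum>i<m. z i * a i, c:])"
  by (auto simp: hom_poly_def coeff_pCons homogeneous_const homogeneous_linear le_Suc_eq
      split: nat.split)

abbreviation pencil :: "nat \<Rightarrow> (nat \<Rightarrow> real mat) \<Rightarrow> (nat \<Rightarrow> real) \<Rightarrow> nat \<Rightarrow> nat \<Rightarrow> real" where
  "pencil m A z r c \<equiv> \<Sum>i<m. z i * A i $$ (r, c)"

abbreviation pencil_poly :: "nat \<Rightarrow> nat \<Rightarrow> (nat \<Rightarrow> real mat) \<Rightarrow> (nat \<Rightarrow> real) \<Rightarrow> real poly" where
  "pencil_poly d m A z \<equiv> char_poly (to_mat d (\<lambda>r c. - pencil m A z r c))"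

lemma pencil_poly_expand:
  "pencil_poly d m A z = (\<Sum>p | p permutes {0..<d}. [:signof p:] *
     (\<Prod>r = 0..<d. [:\<Sum>i<m. z i * A i $$ (r, p r), if r = p r then 1 else 0:]))"
proof -
  have less: "p r < d" if "p permutes {0..<d}" "r < d" for p r
    using permutes_in_image[OF that(1), of r] that(2) by simp
  have "signof p = [:signof p :: real:]" for p :: "nat \<Rightarrow> nat"
    by (cases p rule: sign_cases) (simp_all add: one_pCons)
  then show ?thesis
    unfolding char_poly_def
    by (subst det_def'[of _ d])
      (auto intro!: sum.cong prod.cong arg_cong2[of _ _ _ _ "(*)"] simp: less char_poly_matrix_index[of _ d])
qed

lemma hom_poly_pencil_poly: "hom_poly m d (pencil_poly d m A)"
proof -
  have "hom_poly m (0 + card {0..<d}) (\<lambda>z. [:signof p:] *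
     (\<Prod>r = 0..<d. [:\<Sum>i<m. z i * A i $$ (r, p r), if r = p r then 1 else 0:]))" for p
    by (intro hom_poly_mult hom_poly_const hom_poly_prod hom_poly_linear) simp
  then show ?thesis
    unfolding pencil_poly_expand by (intro hom_poly_sum) simp
qed

lemma poly_pencil_poly: "poly (pencil_poly d m A z) x = pencil_det d m A x z"
proof -
  have less: "p r < d" if "p permutes {0..<d}" "r < d" for p r
    using permutes_in_image[OF that(1), of r] that(2) by simp
  show ?thesis
    unfolding pencil_det_def pencil_poly_expand
    by (subst det_def'[of _ d])
      (auto intro!: sum.cong prod.cong simp: less poly_sum poly_prod)
qed

abbreviation one_minus_partials :: "nat list \<Rightarrow> ((nat \<Rightarrow> real) \<Rightarrow> real) \<Rightarrow> (nat \<Rightarrow> real) \<Rightarrow> real" where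
  "one_minus_partials \<equiv> foldr one_minus_partial"

lemma one_minus_partial_linear:
  assumes "poly_fun (\<lambda>x. f)" "poly_fun (\<lambda>x. g)"
  shows "one_minus_partial i (\<lambda>z. f z + c * g z) =
    (\<lambda>z. one_minus_partial i f z + c * one_minus_partial i g z)"
proof -
  obtain f' where f': "\<And>z. ((\<lambda>t. f (z(i := t))) has_field_derivative f' z) (at (z i))"
    using poly_fun_has_partial[OF assms(1), of i] by blast
  obtain g' where g': "\<And>z. ((\<lambda>t. g (z(i := t))) has_field_derivative g' z) (at (z i))"
    using poly_fun_has_partial[OF assms(2), of i] by blast
  have "((\<lambda>t. f (z(i := t)) + c * g (z(i := t))) has_field_derivative f' z + c * g' z) (at (z i))" for z
    by (intro DERIV_add DERIV_cmult f' g')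
  from DERIV_imp_deriv[OF this] show ?thesis
    by (simp add: one_minus_partial_def partial_deriv_def DERIV_imp_deriv[OF f']
        DERIV_imp_deriv[OF g'] algebra_simps)
qed

lemma poly_fun_one_minus_partials:
  "poly_fun (\<lambda>x. f) \<Longrightarrow> poly_fun (\<lambda>x. one_minus_partials is f)"
  by (induction "is") (auto intro: poly_fun_one_minus_partial)

lemma one_minus_partials_linear:
  assumes "poly_fun (\<lambda>x. f)" "poly_fun (\<lambda>x. g)"
  shows "one_minus_partials is (\<lambda>z. f z + c * g z) =
    (\<lambda>z. one_minus_partials is f z + c * one_minus_partials is g z)"
  by (induction "is")
    (simp_all add: one_minus_partial_linear[OF assms[THEN poly_fun_one_minus_partials]])

lemma one_minus_partials_const_zero: "one_minus_partials is (\<lambda>z. 0) = (\<lambda>z. 0)"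
  by (induction "is") (simp_all add: one_minus_partial_def partial_deriv_def)

lemma one_minus_partials_sum:
  assumes "finite S" "\<And>a. a \<in> S \<Longrightarrow> poly_fun (\<lambda>x. f a)"
  shows "one_minus_partials is (\<lambda>z. \<Sum>a\<in>S. c a * f a z) =
    (\<lambda>z. \<Sum>a\<in>S. c a * one_minus_partials is (f a) z)"
  using assms
proof (induction S rule: finite_induct)
  case empty
  show ?case by (simp add: one_minus_partials_const_zero)
next
  case (insert x F)
  have "poly_fun (\<lambda>y z. \<Sum>a\<in>F. c a * f a z)"
    using insert by (intro poly_fun_sum poly_fun.intros) auto
  from one_minus_partials_linear[OF this, of "f x" "is" "c x"] insert show ?case
    by (simp add: add.commute)
qed

lemma one_minus_partials_prod:
  assumes "finite I" "distinct is" "set is \<subseteq> I"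
    and g: "\<And>i t. (g i has_field_derivative g' i t) (at t)"
  shows "one_minus_partials is (\<lambda>z. \<Prod>i\<in>I. g i (z i)) =
    (\<lambda>z. \<Prod>i\<in>I. if i \<in> set is then g i (z i) - g' i (z i) else g i (z i))"
  using assms(2,3)
proof (induction "is")
  case (Cons i "is")
  let ?h = "\<lambda>is i t. if i \<in> set is then g i t - g' i t else g i t"
  let ?C = "\<lambda>z. \<Prod>l\<in>I - {i}. ?h is l (z l)"
  from Cons.prems have i: "i \<in> I" "i \<notin> set is" by auto
  have split: "(\<Prod>l\<in>I. ?h is l ((z(i := t)) l)) = g i t * ?C z" for z t
    using i by (subst prod.remove[OF assms(1) i(1)]) (auto intro!: prod.cong cong: if_cong)
  have "((\<lambda>t. \<Prod>l\<in>I. ?h is l ((z(i := t)) l)) has_field_derivative g' i (z i) * ?C z) (at (z i))" for z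
    unfolding split by (intro DERIV_cmult_right g)
  from DERIV_imp_deriv[OF this]
  have "one_minus_partial i (\<lambda>z. \<Prod>l\<in>I. ?h is l (z l)) =
      (\<lambda>z. (\<Prod>l\<in>I. ?h is l (z l)) - g' i (z i) * ?C z)"
    by (simp add: one_minus_partial_def partial_deriv_def)
  moreover have "one_minus_partials is (\<lambda>z. \<Prod>i\<in>I. g i (z i)) = (\<lambda>z. \<Prod>l\<in>I. ?h is l (z l))"
    using Cons by auto
  ultimately have "one_minus_partials (i # is) (\<lambda>z. \<Prod>i\<in>I. g i (z i)) =
      (\<lambda>z. (\<Prod>l\<in>I. ?h is l (z l)) - g' i (z i) * ?C z)"
    by simp
  also have "\<dots> = (\<lambda>z. (g i (z i) - g' i (z i)) * ?C z)"
  proof -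
    have "(\<Prod>l\<in>I. ?h is l (z l)) = g i (z i) * ?C z" for z
      using split[of z "z i"] by (simp only: fun_upd_triv)
    then show ?thesis by (simp only: left_diff_distrib)
  qed
  also have "\<dots> = (\<lambda>z. \<Prod>l\<in>I. ?h (i # is) l (z l))"
    using i by (intro ext, subst prod.remove[OF assms(1) i(1)]) (auto intro!: prod.cong)
  finally show ?case by simp
qed simp

lemma monom_fun_count:
  "set w \<subseteq> {..<m} \<Longrightarrow> monom_fun w z = (\<Prod>i<m. z i ^ count_list w i)"
proof (induction w)
  case (Cons x w)
  have "(\<Prod>i<m. z i ^ count_list (x # w) i) = (\<Prod>i<m. (if i = x then z i else 1) * z i ^ count_list w i)"
    by (intro prod.cong) auto
  with Cons show ?case by (simp add: prod.distrib prod.delta)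
qed simp

lemma one_minus_partials_monom:
  assumes "set w \<subseteq> {..<m}"
  shows "one_minus_partials [0..<m] (monom_fun w) (\<lambda>_. 0) =
    (if distinct w then (-1) ^ length w else 0)"
proof -
  let ?h = "\<lambda>i. (0::real) ^ count_list w i - real (count_list w i) * 0 ^ (count_list w i - 1)"
  have D: "((\<lambda>t. t ^ n) has_field_derivative real n * t ^ (n - 1)) (at t)" for n and t :: real
    using DERIV_pow[of n t] by simp
  have "one_minus_partials [0..<m] (monom_fun w) (\<lambda>_. 0) =
      one_minus_partials [0..<m] (\<lambda>z. \<Prod>i<m. z i ^ count_list w i) (\<lambda>_. 0)"
    using monom_fun_count[OF assms] by simp
  also have "\<dots> = (\<Prod>i<m. ?h i)"
    by (subst one_minus_partials_prod[OF _ _ _ D]) auto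
  also have "\<dots> = (if distinct w then (-1) ^ length w else 0)"
  proof (cases "distinct w")
    case True
    have "count_list w i = (if i \<in> set w then 1 else 0)" for i
      using True by (induction w) auto
    then have "(\<Prod>i<m. ?h i) = (\<Prod>i<m. if i \<in> set w then -1 else 1)"
      by (intro prod.cong) auto
    also have "\<dots> = (\<Prod>i\<in>set w. -1)"
      using assms by (intro prod.mono_neutral_cong_right) auto
    finally show ?thesis using True by (simp add: distinct_card)
  next
    case False
    then obtain xs ys zs y where "w = xs @ [y] @ ys @ [y] @ zs"
      using not_distinct_decomp by blast
    then have "y < m" "2 \<le> count_list w y" using assms by auto
    then have "?h y = 0" by (simp add: power_0_left)
    with \<open>y < m\<close> have "(\<Prod>i<m. ?h i) = 0" by (intro prod_zero) auto
    with False show ?thesis by simp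
  qed
  finally show ?thesis .
qed

lemma alternating_sum_supersets:
  assumes "finite S"
  shows "(\<Sum>R\<in>Pow S. if U \<subseteq> R then (-1) ^ card R else 0) =
    (if U = S then (-1) ^ card S else (0 :: real))"
proof (cases "U \<subset> S")
  case True
  have fin: "finite {R. R \<subseteq> S \<and> P R}" for P
    using assms by (auto intro: finite_subset[of _ "Pow S"])
  have "(\<Sum>R\<in>Pow S. if U \<subseteq> R then (-1) ^ card R else 0 :: real) =
      (\<Sum>R | R \<subseteq> S \<and> U \<subseteq> R. (-1) ^ card R)"
    using assms by (intro sum.mono_neutral_cong_right) auto
  also have "{R. R \<subseteq> S \<and> U \<subseteq> R} =
      {R. R \<subseteq> S \<and> U \<subseteq> R \<and> even (card R)} \<union> {R. R \<subseteq> S \<and> U \<subseteq> R \<and> odd (card R)}"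
    by blast
  also have "(\<Sum>R\<in>\<dots>. (-1) ^ card R :: real) =
      (\<Sum>R | R \<subseteq> S \<and> U \<subseteq> R \<and> even (card R). (-1) ^ card R) +
      (\<Sum>R | R \<subseteq> S \<and> U \<subseteq> R \<and> odd (card R). (-1) ^ card R)"
    by (rule sum.union_disjoint) (use fin in auto)
  also have "\<dots> = real (card {R. R \<subseteq> S \<and> U \<subseteq> R \<and> even (card R)})
      - real (card {R. R \<subseteq> S \<and> U \<subseteq> R \<and> odd (card R)})"
    by simp
  also have "\<dots> = 0"
    using card_subsupersets_even_odd[OF assms True] by simp
  finally show ?thesis using True by auto
next
  case False
  have "(\<Sum>R\<in>Pow S. if U \<subseteq> R then (-1) ^ card R else 0 :: real) =
      (\<Sum>R\<in>Pow S. if R = S then if U = S then (-1) ^ card S else 0 else 0)"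
    using False by (intro sum.cong) auto
  with assms show ?thesis by simp
qed

definition alt_sum :: "nat set \<Rightarrow> nat \<Rightarrow> (nat set \<Rightarrow> real) \<Rightarrow> real" where
  "alt_sum X j F = (\<Sum>S | S \<subseteq> X \<and> card S = j. \<Sum>R\<in>Pow S. (-1) ^ card R * F R)"

lemma alt_sum_linear: "alt_sum X j (\<lambda>R. F R + c * G R) = alt_sum X j F + c * alt_sum X j G"
  unfolding alt_sum_def by (simp add: algebra_simps sum.distrib sum_distrib_left)

lemma one_minus_partials_homogeneous:
  assumes "homogeneous m j f"
  shows "one_minus_partials [0..<m] f (\<lambda>_. 0) = alt_sum {..<m} j (\<lambda>R. f (indicator R))"
  using assms
proof induction
  case zero
  show ?case by (simp add: one_minus_partials_const_zero alt_sum_def)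
next
  case (add_monom f w c)
  have ind: "monom_fun w (indicator R) = (if set w \<subseteq> R then 1 else 0)" for R
    by (induction w) (auto simp: indicator_def)
  have fin: "finite S" if "S \<subseteq> {..<m}" for S using that finite_subset by blast
  have "alt_sum {..<m} j (\<lambda>R. monom_fun w (indicator R)) =
      (\<Sum>S | S \<subseteq> {..<m} \<and> card S = j. \<Sum>R\<in>Pow S. if set w \<subseteq> R then (-1) ^ card R else 0)"
    unfolding alt_sum_def ind by (intro sum.cong) auto
  also have "\<dots> = (\<Sum>S | S \<subseteq> {..<m} \<and> card S = j. if set w = S then (-1) ^ j else 0)"
    by (intro sum.cong refl) (auto simp: alternating_sum_supersets fin)
  also have "\<dots> = (if distinct w then (-1) ^ length w else 0)"
    using add_monom.hyps by (simp add: sum.delta' card_distinct distinct_card)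
  finally have "alt_sum {..<m} j (\<lambda>R. monom_fun w (indicator R)) =
      one_minus_partials [0..<m] (monom_fun w) (\<lambda>_. 0)"
    by (simp add: one_minus_partials_monom[OF add_monom.hyps(3)])
  moreover have "poly_fun (\<lambda>x. monom_fun w)"
    using homogeneous_imp_poly_fun[OF homogeneous_monom[OF add_monom.hyps(2,3), of 1]] by simp
  ultimately show ?case
    using one_minus_partials_linear[OF homogeneous_imp_poly_fun[OF add_monom.hyps(1)], of "monom_fun w"]
    by (simp add: alt_sum_linear add_monom.IH)
qed

theorem coeff_mixed_charpoly:
  assumes "k \<le> d"
  shows "coeff (mixed_charpoly d m A) (d - k) =
    alt_sum {..<m} k (\<lambda>R. fl_coeff d (\<lambda>r c. - (\<Sum>i\<in>R. A i $$ (r, c))) k)"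
proof -
  let ?L = "one_minus_partials [0..<m]"
  let ?q = "\<lambda>i z. coeff (pencil_poly d m A z) i"
  have hom: "homogeneous m (d - i) (?q i)" if "i \<le> d" for i
    using hom_poly_pencil_poly[of m d A] that by (simp add: hom_poly_def)
  have deg: "degree (pencil_poly d m A z) \<le> d" for z
    using hom_poly_pencil_poly[of m d A] by (intro degree_le) (simp add: hom_poly_def)
  have "pencil_det d m A x = (\<lambda>z. \<Sum>i\<le>d. x ^ i * ?q i z)" for x
  proof
    fix z
    show "pencil_det d m A x z = (\<Sum>i\<le>d. x ^ i * ?q i z)"
      using arg_cong[OF poly_as_sum_of_monoms'[OF deg[of z]], of "\<lambda>p. poly p x"]
      by (simp flip: poly_pencil_poly add: poly_sum poly_monom mult.commute)
  qed
  then have "mixed_char_fun d m A x = (\<Sum>i\<le>d. x ^ i * ?L (?q i) (\<lambda>_. 0))" for x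
    unfolding mixed_char_fun_def
    by (simp, subst one_minus_partials_sum) (auto intro!: homogeneous_imp_poly_fun[OF hom])
  then have "poly (mixed_charpoly d m A) x = poly (\<Sum>i\<le>d. monom (?L (?q i) (\<lambda>_. 0)) i) x" for x
    by (simp add: poly_mixed_charpoly poly_sum poly_monom mult.commute)
  then have "mixed_charpoly d m A = (\<Sum>i\<le>d. monom (?L (?q i) (\<lambda>_. 0)) i)"
    by (intro poly_eq_poly_eq_iff[THEN iffD1] ext)
  then have "coeff (mixed_charpoly d m A) (d - k) = ?L (?q (d - k)) (\<lambda>_. 0)"
    by (simp add: coeff_sum)
  also have "\<dots> = alt_sum {..<m} k (\<lambda>R. ?q (d - k) (indicator R))"
    using one_minus_partials_homogeneous[OF hom[of "d - k"]] assms by simp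
  also have "\<dots> = alt_sum {..<m} k (\<lambda>R. fl_coeff d (\<lambda>r c. - (\<Sum>i\<in>R. A i $$ (r, c))) k)"
    unfolding alt_sum_def
  proof (intro sum.cong refl arg_cong2[of _ _ _ _ "(*)"])
    fix S R assume "S \<in> {S. S \<subseteq> {..<m} \<and> card S = k}" "R \<in> Pow S"
    then have "R \<subseteq> {..<m}" by auto
    then have "pencil m A (indicator R) r c = (\<Sum>i\<in>R. A i $$ (r, c))" for r c
      by (intro sum.mono_neutral_cong_right) (auto simp: indicator_def)
    then show "?q (d - k) (indicator R) = fl_coeff d (\<lambda>r c. - (\<Sum>i\<in>R. A i $$ (r, c))) k"
      by (simp add: fl_coeff_correct[OF assms])
  qed
  finally show ?thesis .
qed

section \<open>Enumerating the alternating sum\<close>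

lemma sum_Pow_insert:
  assumes "finite S" "i \<notin> S"
  shows "(\<Sum>R\<in>Pow (insert i S). f R :: real) = (\<Sum>R\<in>Pow S. f R + f (insert i R))"
proof -
  have "inj_on (insert i) (Pow S)" using assms(2) by (auto simp: inj_on_def)
  moreover have "Pow S \<inter> insert i ` Pow S = {}" using assms(2) by auto
  ultimately show ?thesis
    using assms(1) by (simp add: Pow_insert sum.union_disjoint sum.reindex sum.distrib)
qed

lemma alt_sum_0: "alt_sum X 0 F = F {}" if "finite X"
proof -
  have "{S. S \<subseteq> X \<and> card S = 0} = {{}}" using that finite_subset by fastforce
  then show ?thesis by (simp add: alt_sum_def)
qed

text \<open>The sets are split according to their least element.\<close>

lemma alt_sum_Suc:
  "alt_sum {lo..<m} (Suc j) F =
    (\<Sum>i\<in>{lo..<m}. alt_sum {Suc i..<m} j F - alt_sum {Suc i..<m} j (\<lambda>R. F (insert i R)))"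
proof -
  let ?T = "\<lambda>i. {S. S \<subseteq> {Suc i..<m} \<and> card S = j}"
  let ?h = "\<lambda>S. \<Sum>R\<in>Pow S. (-1) ^ card R * F R"
  have "finite (?T i)" for i
    by (rule finite_subset[of _ "Pow {Suc i..<m}"]) auto
  then have "(\<Sum>i\<in>{lo..<m}. \<Sum>S\<in>?T i. ?h (insert i S)) =
      (\<Sum>(i, S)\<in>(SIGMA i:{lo..<m}. ?T i). ?h (insert i S))"
    by (intro sum.Sigma) auto
  also have "\<dots> = (\<Sum>S | S \<subseteq> {lo..<m} \<and> card S = Suc j. ?h S)"
  proof (rule sum.reindex_bij_witness[of _ "\<lambda>S. (Min S, S - {Min S})" "\<lambda>(i, S). insert i S"])
    fix p assume p: "p \<in> (SIGMA i:{lo..<m}. ?T i)"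
    obtain i S where [simp]: "p = (i, S)" by (cases p)
    from p have S: "lo \<le> i" "i < m" "S \<subseteq> {Suc i..<m}" "card S = j" by auto
    then have fin: "finite S" and "i \<notin> S" using finite_subset by auto
    moreover have "Min (insert i S) = i"
      using S fin by (intro Min_eqI) auto
    ultimately show "(case p of (i, S) \<Rightarrow> insert i S) \<in> {S. S \<subseteq> {lo..<m} \<and> card S = Suc j}"
      "(\<lambda>S. (Min S, S - {Min S})) (case p of (i, S) \<Rightarrow> insert i S) = p"
      using S by auto
    show "?h (case p of (i, S) \<Rightarrow> insert i S) = (case p of (i, S) \<Rightarrow> ?h (insert i S))"
      by simp
  next
    fix S assume "S \<in> {S. S \<subseteq> {lo..<m} \<and> card S = Suc j}"
    then have S: "S \<subseteq> {lo..<m}" "card S = Suc j" by auto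
    then have fin: "finite S" and "S \<noteq> {}" using finite_subset by auto
    then have Min: "Min S \<in> S" "\<And>x. x \<in> S \<Longrightarrow> Min S \<le> x" by auto
    show "(case (Min S, S - {Min S}) of (i, S) \<Rightarrow> insert i S) = S"
      using Min by auto
    have "Suc (Min S) \<le> x" if "x \<in> S - {Min S}" for x
      using Min(2)[of x] that by auto
    then show "(Min S, S - {Min S}) \<in> (SIGMA i:{lo..<m}. ?T i)"
      using S Min fin by (auto simp: subset_eq)
  qed
  finally have "alt_sum {lo..<m} (Suc j) F = (\<Sum>i\<in>{lo..<m}. \<Sum>S\<in>?T i. ?h (insert i S))"
    by (simp add: alt_sum_def)
  also have "\<dots> =
      (\<Sum>i\<in>{lo..<m}. alt_sum {Suc i..<m} j F - alt_sum {Suc i..<m} j (\<lambda>R. F (insert i R)))"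
  proof (rule sum.cong[OF refl])
    fix i
    have "?h (insert i S) = ?h S - (\<Sum>R\<in>Pow S. (-1) ^ card R * F (insert i R))" if "S \<in> ?T i" for S
    proof -
      from that have S: "finite S" "i \<notin> S" using finite_subset by auto
      have "(-1) ^ card (insert i R) = - ((-1) ^ card R :: real)" if "R \<in> Pow S" for R
        using S that by (subst card_insert_disjoint) (auto intro: finite_subset)
      then show ?thesis
        using S by (simp add: sum_Pow_insert sum_subtractf)
    qed
    then show "(\<Sum>S\<in>?T i. ?h (insert i S)) =
        alt_sum {Suc i..<m} j F - alt_sum {Suc i..<m} j (\<lambda>R. F (insert i R))"
      by (simp add: alt_sum_def sum_subtractf)
  qed
  finally show ?thesis .
qed

text \<open>The number \<open>q\<close> encodes in base \<open>2 m\<close> a list of digits, least significant first. A digit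
  \<open>i\<close> or \<open>m + i\<close> puts \<open>i\<close> into the set \<open>S\<close> of the alternating sum, and the former also into \<open>R\<close>.
  The sign drops to zero as soon as the digits fail to list \<open>S\<close> in increasing order.\<close>

definition digit_elem :: "nat \<Rightarrow> nat \<Rightarrow> nat" where
  "digit_elem m a = (if a < m then a else a - m)"

definition digit_sign :: "nat \<Rightarrow> nat \<Rightarrow> nat \<Rightarrow> real \<Rightarrow> real" where
  "digit_sign m lo a sg = (if digit_elem m a < lo then 0 else if a < m then - sg else sg)"

definition digit_matrix ::
    "nat \<Rightarrow> (nat \<Rightarrow> real mat) \<Rightarrow> nat \<Rightarrow> (nat \<Rightarrow> nat \<Rightarrow> real) \<Rightarrow> nat \<Rightarrow> nat \<Rightarrow> real" where
  "digit_matrix m A a M = (if a < m then \<lambda>r c. M r c - A a $$ (r, c) else M)"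

primrec code_term :: "nat \<Rightarrow> (nat \<Rightarrow> real mat) \<Rightarrow> ((nat \<Rightarrow> nat \<Rightarrow> real) \<Rightarrow> real) \<Rightarrow>
    nat \<Rightarrow> nat \<Rightarrow> real \<Rightarrow> (nat \<Rightarrow> nat \<Rightarrow> real) \<Rightarrow> nat \<Rightarrow> real" where
  "code_term m A F 0 lo sg M q = sg * F M"
| "code_term m A F (Suc j) lo sg M q = (let a = q mod (2 * m) in
     code_term m A F j (Suc (digit_elem m a)) (digit_sign m lo a sg) (digit_matrix m A a M) (q div (2 * m)))"

lemma sum_code_term:
  "(\<Sum>q<(2 * m) ^ j. code_term m A F j lo sg M q) =
    sg * alt_sum {lo..<m} j (\<lambda>R. F (\<lambda>r c. M r c - (\<Sum>i\<in>R. A i $$ (r, c))))"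
proof (induction j arbitrary: lo sg M)
  case 0
  show ?case by (simp add: alt_sum_0)
next
  case (Suc j)
  let ?b = "2 * m"
  let ?G = "\<lambda>M R. F (\<lambda>r c. M r c - (\<Sum>i\<in>R. A i $$ (r, c)))"
  let ?t = "\<lambda>a q. code_term m A F j (Suc (digit_elem m a)) (digit_sign m lo a sg) (digit_matrix m A a M) q"
  have "(\<Sum>q<?b ^ Suc j. code_term m A F (Suc j) lo sg M q) =
      (\<Sum>q<?b ^ j. \<Sum>n\<in>{q * ?b..<q * ?b + ?b}. ?t (n mod ?b) (n div ?b))"
    by (simp only: power_Suc2 sum.nat_group[symmetric] code_term.simps Let_def)
  also have "\<dots> = (\<Sum>q<?b ^ j. \<Sum>a<?b. ?t a q)"
  proof (rule sum.cong[OF refl])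
    fix q
    have *: "n div ?b = q" "n mod ?b = n - q * ?b" if "n \<in> {q * ?b..<q * ?b + ?b}" for n
    proof -
      show "n div ?b = q" using that by (intro div_nat_eqI) (auto simp: mult.commute)
      then show "n mod ?b = n - q * ?b" by (simp add: modulo_nat_def)
    qed
    show "(\<Sum>n\<in>{q * ?b..<q * ?b + ?b}. ?t (n mod ?b) (n div ?b)) = (\<Sum>a<?b. ?t a q)"
      by (rule sum.reindex_bij_witness[of _ "\<lambda>a. q * ?b + a" "\<lambda>n. n - q * ?b"])
        (use * in auto)
  qed
  also have "\<dots> = (\<Sum>a<?b. \<Sum>q<?b ^ j. ?t a q)" by (rule sum.swap)
  also have "\<dots> = (\<Sum>a<m. \<Sum>q<?b ^ j. ?t a q) + (\<Sum>a\<in>{m..<?b}. \<Sum>q<?b ^ j. ?t a q)"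
    by (subst sum.union_disjoint[symmetric]) (auto intro!: sum.cong)
  also have "(\<Sum>a\<in>{m..<?b}. \<Sum>q<?b ^ j. ?t a q) = (\<Sum>a<m. \<Sum>q<?b ^ j. ?t (m + a) q)"
    by (rule sum.reindex_bij_witness[of _ "\<lambda>a. m + a" "\<lambda>a. a - m"]) auto
  also have "(\<Sum>a<m. \<Sum>q<?b ^ j. ?t a q) + \<dots> = (\<Sum>a<m. if a < lo then 0 else
      sg * (alt_sum {Suc a..<m} j (?G M) - alt_sum {Suc a..<m} j (\<lambda>R. ?G M (insert a R))))"
  proof (subst sum.distrib[symmetric], rule sum.cong[OF refl])
    fix a assume "a \<in> {..<m}"
    moreover have "alt_sum {Suc a..<m} j (?G (\<lambda>r c. M r c - A a $$ (r, c))) =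
        alt_sum {Suc a..<m} j (\<lambda>R. ?G M (insert a R))"
      unfolding alt_sum_def
    proof (intro sum.cong refl arg_cong2[of _ _ _ _ "(*)"])
      fix S R assume "S \<in> {S. S \<subseteq> {Suc a..<m} \<and> card S = j}" "R \<in> Pow S"
      then have R: "R \<subseteq> {Suc a..<m}" by auto
      then have "finite R" "a \<notin> R" using finite_subset by auto
      then show "?G (\<lambda>r c. M r c - A a $$ (r, c)) R = ?G M (insert a R)"
        by (simp add: diff_diff_eq)
    qed
    ultimately show "(\<Sum>q<?b ^ j. ?t a q) + (\<Sum>q<?b ^ j. ?t (m + a) q) = (if a < lo then 0 else
        sg * (alt_sum {Suc a..<m} j (?G M) - alt_sum {Suc a..<m} j (\<lambda>R. ?G M (insert a R))))"
      unfolding Suc.IH by (simp add: digit_elem_def digit_sign_def digit_matrix_def algebra_simps)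
  qed
  also have "\<dots> = (\<Sum>a\<in>{lo..<m}.
      sg * (alt_sum {Suc a..<m} j (?G M) - alt_sum {Suc a..<m} j (\<lambda>R. ?G M (insert a R))))"
    by (intro sum.mono_neutral_cong_right) auto
  also have "\<dots> = sg * alt_sum {lo..<m} (Suc j) (?G M)"
    unfolding alt_sum_Suc sum_distrib_left ..
  finally show ?case .
qed

lemma coeff_mixed_charpoly_sum:
  assumes "k \<le> d"
  shows "coeff (mixed_charpoly d m A) (d - k) =
    (\<Sum>q<(2 * m) ^ k. code_term m A (\<lambda>M. fl_coeff d M k) k 0 1 (\<lambda>r c. 0) q)"
  by (subst sum_code_term) (simp add: coeff_mixed_charpoly[OF assms] lessThan_atLeast0)

lemma coeff_mixed_charpoly_eq_0:
  assumes "k \<le> d" "m < k"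
  shows "coeff (mixed_charpoly d m A) (d - k) = 0"
proof -
  have "card S \<noteq> k" if "S \<subseteq> {..<m}" for S
    using card_mono[OF _ that] assms(2) by simp
  then have *: "{S. S \<subseteq> {..<m} \<and> card S = k} = {}" by blast
  show ?thesis unfolding coeff_mixed_charpoly[OF assms(1)] alt_sum_def * by simp
qed

section \<open>Running time of programs\<close>

text \<open>The time bound is kept as a product, of a numeral and a polynomial in the input size, so that
  sequencing only adds numerals and loops only multiply polynomials.\<close>

definition reaches :: "prog \<Rightarrow> (nat \<Rightarrow> nat) \<Rightarrow> (nat \<Rightarrow> real) \<Rightarrow> nat \<Rightarrow> nat \<Rightarrow>
    ((nat \<Rightarrow> nat) \<Rightarrow> (nat \<Rightarrow> real) \<Rightarrow> bool) \<Rightarrow> bool" where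
  "reaches P f g K X Q \<longleftrightarrow> (\<exists>t f' g'. runs P (f, g) t (f', g') \<and> t \<le> K * X \<and> Q f' g')"

lemma reachesI: "runs P (f, g) t (f', g') \<Longrightarrow> t \<le> K * X \<Longrightarrow> Q f' g' \<Longrightarrow> reaches P f g K X Q"
  by (auto simp: reaches_def)

lemma reaches_weaken:
  assumes "reaches P f g K X Q" "K \<le> K'" "X \<le> X'" "\<And>f' g'. Q f' g' \<Longrightarrow> Q' f' g'"
  shows "reaches P f g K' X' Q'"
proof -
  from assms(1) obtain t f' g' where "runs P (f, g) t (f', g')" "t \<le> K * X" "Q f' g'"
    by (auto simp: reaches_def)
  with assms(4) mult_le_mono[OF assms(2,3)] show ?thesis by (auto intro!: reachesI)
qed

lemma reaches_time: "reaches P f g K X Q \<Longrightarrow> K \<le> K' \<Longrightarrow> X \<le> X' \<Longrightarrow> reaches P f g K' X' Q"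
  by (rule reaches_weaken)

lemma reaches_cost: "reaches P f g K X Q \<Longrightarrow> K \<le> K' \<Longrightarrow> reaches P f g K' X Q"
  by (rule reaches_time) auto

lemma reaches_Skip: "Q f g \<Longrightarrow> 0 < X \<Longrightarrow> reaches Skip f g 1 X Q"
  by (rule reachesI[OF runs.Skip]) auto

lemma le_mult_pos: "0 < X \<Longrightarrow> c \<le> c * (X :: nat)"
  by simp

lemma reaches_ISet:
  "Q (f(ival a (f, g) := ival e (f, g))) g \<Longrightarrow> 0 < X \<Longrightarrow>
    reaches (ISet a e) f g (icost a + icost e + 1) X Q"
  using runs.ISet[of a e "(f, g)"] by (intro reachesI[OF _ le_mult_pos]) auto

lemma reaches_RSet:
  "Q f (g(ival a (f, g) := rval e (f, g))) \<Longrightarrow> 0 < X \<Longrightarrow>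
    reaches (RSet a e) f g (icost a + rcost e + 1) X Q"
  using runs.RSet[of a e "(f, g)"] by (intro reachesI[OF _ le_mult_pos]) auto

lemma reaches_Seq:
  assumes "reaches P f g K X (\<lambda>f' g'. reaches Q f' g' L X R)"
  shows "reaches (Seq P Q) f g (K + L) X R"
proof -
  from assms obtain t f' g' u f'' g'' where
    "runs P (f, g) t (f', g')" "t \<le> K * X" "runs Q (f', g') u (f'', g'')" "u \<le> L * X" "R f'' g''"
    by (auto simp: reaches_def)
  then show ?thesis by (intro reachesI[OF runs.Seq]) (auto simp: distrib_right)
qed

lemma reaches_then:
  assumes "reaches P f g K X R" "\<And>f' g'. R f' g' \<Longrightarrow> reaches Q f' g' L X S"
  shows "reaches (Seq P Q) f g (K + L) X S"
  by (rule reaches_Seq, rule reaches_weaken[OF assms(1)]) (auto intro: assms(2))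

lemma reaches_If:
  assumes "holds b (f, g) \<Longrightarrow> reaches P f g K X R" "\<not> holds b (f, g) \<Longrightarrow> reaches Q f g L X R" "0 < X"
  shows "reaches (If b P Q) f g (tcost b + max K L) X R"
proof (cases "holds b (f, g)")
  case True
  with assms(1) obtain t f' g' where *: "runs P (f, g) t (f', g')" "t \<le> K * X" "R f' g'"
    by (auto simp: reaches_def)
  have "tcost b + t \<le> tcost b * X + max K L * X"
    using *(2) assms(3) by (intro add_mono order.trans[OF *(2)]) auto
  with * show ?thesis by (intro reachesI[OF runs.IfTrue[OF True]]) (auto simp: distrib_right)
next
  case False
  with assms(2) obtain t f' g' where *: "runs Q (f, g) t (f', g')" "t \<le> L * X" "R f' g'"
    by (auto simp: reaches_def)
  have "tcost b + t \<le> tcost b * X + max K L * X"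
    using *(2) assms(3) by (intro add_mono order.trans[OF *(2)]) auto
  with * show ?thesis by (intro reachesI[OF runs.IfFalse[OF False]]) (auto simp: distrib_right)
qed

lemma runs_While:
  assumes "I i f g" "i \<le> n"
    and step: "\<And>i f g. i < n \<Longrightarrow> I i f g \<Longrightarrow> holds b (f, g) \<and> reaches P f g K X (I (Suc i))"
    and stop: "\<And>f g. I n f g \<Longrightarrow> \<not> holds b (f, g) \<and> Q f g"
  shows "\<exists>t f' g'. runs (While b P) (f, g) t (f', g') \<and>
    t \<le> (n - i) * (tcost b + K * X) + tcost b \<and> Q f' g'"
  using assms(1,2)
proof (induction "n - i" arbitrary: i f g)
  case 0
  then have "i = n" by simp
  with 0 stop[of f g] have "runs (While b P) (f, g) (tcost b) (f, g)" "Q f g"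
    by (auto intro: runs.WhileFalse)
  then show ?case by fastforce
next
  case (Suc l)
  then have "i < n" by simp
  from step[OF this Suc.prems(1)] obtain t f' g' where t: "holds b (f, g)"
    "runs P (f, g) t (f', g')" "t \<le> K * X" "I (Suc i) f' g'"
    by (auto simp: reaches_def)
  from Suc.hyps(1)[OF _ t(4)] Suc.hyps(2) \<open>i < n\<close> obtain u f'' g'' where
    u: "runs (While b P) (f', g') u (f'', g'')" "u \<le> (n - Suc i) * (tcost b + K * X) + tcost b" "Q f'' g''"
    by force
  have "n - i = Suc (n - Suc i)" using \<open>i < n\<close> by simp
  then have "tcost b + t + u \<le> (n - i) * (tcost b + K * X) + tcost b"
    using t(3) u(2) by simp
  with runs.WhileTrue[OF t(1,2) u(1)] u(3) show ?case by blast
qed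

lemma reaches_While:
  assumes "I 0 f g"
    and "\<And>i f g. i < n \<Longrightarrow> I i f g \<Longrightarrow> holds b (f, g) \<and> reaches P f g K X (I (Suc i))"
    and "\<And>f g. I n f g \<Longrightarrow> \<not> holds b (f, g) \<and> Q f g"
    and "n \<le> Y" "0 < X" "0 < Y"
  shows "reaches (While b P) f g (K + 2 * tcost b) (X * Y) Q"
proof -
  from runs_While[where I = I and i = 0 and n = n, OF assms(1) _ assms(2,3)] obtain t f' g' where
    t: "runs (While b P) (f, g) t (f', g')" "t \<le> n * (tcost b + K * X) + tcost b" "Q f' g'"
    by auto
  have "tcost b \<le> tcost b * X" using assms(5) by simp
  then have "n * (tcost b + K * X) \<le> Y * (tcost b * X + K * X)"
    using assms(4) by (intro mult_le_mono) auto
  moreover have "tcost b \<le> tcost b * (X * Y)" using assms(5,6) by simp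
  ultimately have "t \<le> Y * (tcost b * X + K * X) + tcost b * (X * Y)"
    using t(2) by linarith
  also have "\<dots> = (K + 2 * tcost b) * (X * Y)" by (simp add: algebra_simps)
  finally show ?thesis using t by (intro reachesI)
qed

abbreviation reg :: "nat \<Rightarrow> iexp" where
  "reg v \<equiv> IMem (IConst v)"

definition For :: "nat \<Rightarrow> iexp \<Rightarrow> prog \<Rightarrow> prog" where
  "For v e P = Seq (ISet (IConst v) (IConst 0))
     (While (ILess (reg v) e) (Seq P (ISet (IConst v) (IAdd (reg v) (IConst 1)))))"

lemma reaches_For:
  assumes init: "I 0 (f(v := 0)) g"
    and body: "\<And>i f g. i < n \<Longrightarrow> I i f g \<Longrightarrow> f v = i \<Longrightarrow>
      reaches P f g K X (\<lambda>f' g'. f' v = i \<and> I (Suc i) (f'(v := Suc i)) g')"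
    and bound: "\<And>i f g. i \<le> n \<Longrightarrow> I i f g \<Longrightarrow> f v = i \<Longrightarrow> ival e (f, g) = n"
    and exit: "\<And>f g. I n f g \<Longrightarrow> f v = n \<Longrightarrow> Q f g"
    and "n \<le> Y" "0 < X" "0 < Y"
  shows "reaches (For v e P) f g (K + 2 * icost e + 15) (X * Y) Q"
proof -
  have XY: "0 < X * Y" using assms(6,7) by simp
  have "reaches (While (ILess (reg v) e) (Seq P (ISet (IConst v) (IAdd (reg v) (IConst 1)))))
      (f(v := 0)) g ((K + 6) + 2 * (icost e + 3)) (X * Y) Q"
  proof (rule reaches_weaken)
    show "reaches (While (ILess (reg v) e) (Seq P (ISet (IConst v) (IAdd (reg v) (IConst 1)))))
        (f(v := 0)) g ((K + 6) + 2 * tcost (ILess (reg v) e)) (X * Y) Q"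
    proof (rule reaches_While[where I = "\<lambda>i f g. I i f g \<and> f v = i" and n = n])
      fix i f g assume i: "i < n" "I i f g \<and> f v = i"
      have "reaches (Seq P (ISet (IConst v) (IAdd (reg v) (IConst 1)))) f g (K + 6) X
          (\<lambda>f g. I (Suc i) f g \<and> f v = Suc i)"
      proof (rule reaches_then)
        show "reaches P f g K X (\<lambda>f' g'. f' v = i \<and> I (Suc i) (f'(v := Suc i)) g')"
          using i by (intro body) auto
        fix f' g' assume "f' v = i \<and> I (Suc i) (f'(v := Suc i)) g'"
        then show "reaches (ISet (IConst v) (IAdd (reg v) (IConst 1))) f' g' 6 X
            (\<lambda>f g. I (Suc i) f g \<and> f v = Suc i)"
          using \<open>0 < X\<close> by (intro reaches_time[OF reaches_ISet]) auto
      qed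
      then show "holds (ILess (reg v) e) (f, g) \<and>
          reaches (Seq P (ISet (IConst v) (IAdd (reg v) (IConst 1)))) f g (K + 6) X
          (\<lambda>f g. I (Suc i) f g \<and> f v = Suc i)"
        using i bound[of i f g] by simp
    qed (use assms bound[of n] in auto)
  qed auto
  then have "reaches (For v e P) f g (3 + ((K + 6) + 2 * (icost e + 3))) (X * Y) Q"
    unfolding For_def using XY by (intro reaches_Seq reaches_time[OF reaches_ISet]) auto
  then show ?thesis by (rule reaches_time) auto
qed

definition keeps :: "nat \<Rightarrow> (nat \<Rightarrow> 'a) \<Rightarrow> (nat \<Rightarrow> 'a) \<Rightarrow> bool" where
  "keeps n f f' \<longleftrightarrow> (\<forall>a<n. f' a = f a)"

lemma keeps_refl [simp]: "keeps n f f"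
  by (simp add: keeps_def)

lemma keeps_upd [simp]: "n \<le> v \<Longrightarrow> keeps n f (f'(v := x)) = keeps n f f'"
  by (auto simp: keeps_def)

definition block :: "nat \<Rightarrow> (nat \<Rightarrow> real) \<Rightarrow> nat \<Rightarrow> (nat \<Rightarrow> nat \<Rightarrow> real) \<Rightarrow> bool" where
  "block d g b X \<longleftrightarrow> (\<forall>r<d. \<forall>c<d. g (b + r * d + c) = X r c)"

lemma blockD: "block d g b X \<Longrightarrow> r < d \<Longrightarrow> c < d \<Longrightarrow> g (b + r * d + c) = X r c"
  by (simp add: block_def)

lemma row_major_less:
  assumes "r < n" "c < (d :: nat)"
  shows "r * d + c < n * d"
proof -
  have "r * d + c < Suc r * d" using assms(2) by simp
  also have "\<dots> \<le> n * d" using assms(1) by (intro mult_le_mono1) simp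
  finally show ?thesis .
qed

lemma row_major_eq_iff:
  assumes "c < d" "c' < d"
  shows "r * d + c = r' * d + c' \<longleftrightarrow> r = r' \<and> c = (c' :: nat)"
proof
  assume *: "r * d + c = r' * d + c'"
  have "(r * d + c) div d = r" "(r' * d + c') div d = r'" using assms by auto
  with * show "r = r' \<and> c = c'" by simp
qed simp

lemma block_keeps:
  assumes "block d g b X" "keeps n g g'" "b + d * d \<le> n"
  shows "block d g' b X"
  unfolding block_def
proof (intro allI impI)
  fix r c assume "r < d" "c < d"
  then show "g' (b + r * d + c) = X r c"
    using row_major_less[of r d c d] assms by (simp add: keeps_def blockD)
qed

definition clear :: "nat \<Rightarrow> prog" where
  "clear b = For 17 (reg 3) (RSet (IAdd (reg b) (reg 17)) (RConst 0))"

lemma reaches_clear: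
  assumes "b < 17" "f 3 = d * d"
  shows "reaches (clear b) f g 50 (Suc d ^ 2)
    (\<lambda>f' g'. keeps 17 f f' \<and> keeps (f b) g g' \<and> block d g' (f b) (\<lambda>r c. 0))"
  unfolding clear_def
proof (rule reaches_weaken)
  show "reaches (For 17 (reg 3) (RSet (IAdd (reg b) (reg 17)) (RConst 0))) f g
      (7 + 2 * icost (reg 3) + 15) (1 * Suc d ^ 2)
      (\<lambda>f' g'. keeps 17 f f' \<and> keeps (f b) g g' \<and> (\<forall>i<d * d. g' (f b + i) = 0))"
  proof (rule reaches_For[where n = "d * d" and
        I = "\<lambda>n f' g'. keeps 17 f f' \<and> keeps (f b) g g' \<and> (\<forall>i<n. g' (f b + i) = 0)"])
    fix i f' g'
    assume "keeps 17 f f' \<and> keeps (f b) g g' \<and> (\<forall>l<i. g' (f b + l) = 0)" "f' 17 = i"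
    then show "reaches (RSet (IAdd (reg b) (reg 17)) (RConst 0)) f' g' 7 1
        (\<lambda>f'' g''. f'' 17 = i \<and> keeps 17 f (f''(17 := Suc i)) \<and> keeps (f b) g g'' \<and>
          (\<forall>l<Suc i. g'' (f b + l) = 0))"
      using assms by (intro reaches_time[OF reaches_RSet]) (auto simp: keeps_def less_Suc_eq)
  qed (use assms in \<open>auto simp: keeps_def power2_eq_square\<close>)
qed (auto simp: block_def add.assoc row_major_less)

definition add_diag :: "nat \<Rightarrow> rexp \<Rightarrow> prog" where
  "add_diag b e = Seq (ISet (IConst 18) (reg b)) (For 17 (reg 0)
     (Seq (RSet (reg 18) (RAdd (RMem (reg 18)) e))
       (ISet (IConst 18) (IAdd (reg 18) (IAdd (reg 0) (IConst 1))))))"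

lemma reaches_add_diag:
  assumes b: "b < 17" "f 0 = d" and X: "block d g (f b) X" and "rcost e \<le> 10"
    and e: "\<And>f' g'. keeps 17 f f' \<Longrightarrow> keeps (f b) g g' \<Longrightarrow> rval e (f', g') = x"
  shows "reaches (add_diag b e) f g 100 (Suc d)
    (\<lambda>f' g'. keeps 17 f f' \<and> keeps (f b) g g' \<and>
       block d g' (f b) (\<lambda>r c. X r c + (if r = c then x else 0)))"
proof -
  let ?body = "Seq (RSet (reg 18) (RAdd (RMem (reg 18)) e))
       (ISet (IConst 18) (IAdd (reg 18) (IAdd (reg 0) (IConst 1))))"
  let ?I = "\<lambda>i f' g'. keeps 17 f f' \<and> f' 18 = f b + i * d + i \<and> keeps (f b) g g' \<and>
     block d g' (f b) (\<lambda>r c. X r c + (if r = c \<and> r < i then x else 0))"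
  have loop: "reaches (For 17 (reg 0) ?body) (f(18 := f b)) g (30 + 2 * icost (reg 0) + 15) (1 * Suc d)
      (\<lambda>f' g'. keeps 17 f f' \<and> keeps (f b) g g' \<and>
        block d g' (f b) (\<lambda>r c. X r c + (if r = c then x else 0)))"
  proof (rule reaches_For[where n = d and I = ?I])
    fix i f' g' assume i: "i < d" "?I i f' g'" "f' 17 = i"
    define h where "h = g'(f b + i * d + i := X i i + x)"
    have "g' (f b + i * d + i) = X i i" using i(1,2) blockD by fastforce
    moreover have "rval e (f', g') = x" using i(2) e by blast
    moreover have "keeps (f b) g h" using i(2) by (simp add: h_def)
    moreover have "block d h (f b) (\<lambda>r c. X r c + (if r = c \<and> r < Suc i then x else 0))"
      unfolding block_def
    proof (intro allI impI)
      fix r c assume rc: "r < d" "c < d"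
      have "f b + r * d + c = f b + i * d + i \<longleftrightarrow> r = i \<and> c = i"
        using rc i(1) row_major_eq_iff[of c d i r i] by (simp add: add.assoc)
      moreover from i(2) have
        "block d g' (f b) (\<lambda>r c. X r c + (if r = c \<and> r < i then x else 0))" by blast
      from blockD[OF this rc] have "g' (f b + r * d + c) = X r c + (if r = c \<and> r < i then x else 0)" .
      ultimately show "h (f b + r * d + c) = X r c + (if r = c \<and> r < Suc i then x else 0)"
        by (auto simp: h_def)
    qed
    ultimately show "reaches ?body f' g' 30 1 (\<lambda>f'' g''. f'' 17 = i \<and> ?I (Suc i) (f''(17 := Suc i)) g'')"
      using i b assms(4)
      by - (rule reaches_cost, (rule reaches_Seq reaches_ISet reaches_RSet)+, auto simp: keeps_def h_def)
  next
    fix f' g' assume "?I d f' g'"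
    moreover have "block d g' (f b) (\<lambda>r c. X r c + (if r = c \<and> r < d then x else 0)) \<longleftrightarrow>
        block d g' (f b) (\<lambda>r c. X r c + (if r = c then x else 0))"
      by (simp add: block_def)
    ultimately show "keeps 17 f f' \<and> keeps (f b) g g' \<and>
        block d g' (f b) (\<lambda>r c. X r c + (if r = c then x else 0))"
      by blast
  qed (use b X in \<open>auto simp: keeps_def\<close>)
  show ?thesis
    unfolding add_diag_def
    by (rule reaches_cost, rule reaches_Seq, rule reaches_ISet) (use loop in auto)
qed

section \<open>Programs for matrices\<close>

text \<open>The index cells hold: 0-2 the input \<open>d\<close>, \<open>m\<close>, \<open>k\<close>; 3 \<open>d\<^sup>2\<close>; 4 the first real cell behind the
  input; 5 the address of the current matrix; 6 \<open>2 m\<close>; 7 \<open>(2 m)\<^sup>k\<close>; 8 the current code; 9 its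
  undecoded part; 10 the least admissible next element; 11 the digit counter; 12 the decoded element;
  13 the quotient; 14 and 15 the addresses of the last and the next matrix of the recursion;
  16 the step counter of the recursion; 17-22 are temporary.
  Real scalars behind the input: 0 the result so far, 1 the sign, 2 the last coefficient of the
  characteristic polynomial, 3 the step counter of the recursion.\<close>

abbreviation scalar :: "nat \<Rightarrow> iexp" where
  "scalar i \<equiv> IAdd (reg 4) (IConst i)"

definition trace :: prog where
  "trace = Seq (RSet (scalar 2) (RConst 0)) (Seq (ISet (IConst 18) (reg 15))
     (For 17 (reg 0) (Seq (RSet (scalar 2) (RSub (RMem (scalar 2)) (RMem (reg 18))))
       (ISet (IConst 18) (IAdd (reg 18) (IAdd (reg 0) (IConst 1)))))))"

lemma reaches_trace:
  assumes f: "f 0 = d" "f 4 + 2 < f 15" and X: "block d g (f 15) X"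
  shows "reaches trace f g 100 (Suc d)
    (\<lambda>f' g'. keeps 17 f f' \<and> g' = g(f 4 + 2 := - (\<Sum>i<d. X i i)))"
proof -
  let ?body = "Seq (RSet (scalar 2) (RSub (RMem (scalar 2)) (RMem (reg 18))))
       (ISet (IConst 18) (IAdd (reg 18) (IAdd (reg 0) (IConst 1))))"
  let ?I = "\<lambda>i f' g'. keeps 17 f f' \<and> f' 18 = f 15 + i * d + i \<and>
      g' = g(f 4 + 2 := - (\<Sum>l<i. X l l))"
  have loop: "reaches (For 17 (reg 0) ?body) (f(18 := f 15)) (g(f 4 + 2 := 0))
      (30 + 2 * icost (reg 0) + 15) (1 * Suc d)
      (\<lambda>f' g'. keeps 17 f f' \<and> g' = g(f 4 + 2 := - (\<Sum>i<d. X i i)))"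
  proof (rule reaches_For[where n = d and I = ?I])
    fix i f' g' assume i: "i < d" "?I i f' g'" "f' 17 = i"
    with X have "g (f 15 + i * d + i) = X i i" by (simp add: blockD)
    with i show "reaches ?body f' g' 30 1 (\<lambda>f'' g''. f'' 17 = i \<and> ?I (Suc i) (f''(17 := Suc i)) g'')"
      using f
      by - (rule reaches_cost, (rule reaches_Seq reaches_ISet reaches_RSet)+, auto simp: keeps_def fun_upd_def)
  qed (use f in \<open>auto simp: keeps_def\<close>)
  show ?thesis
    unfolding trace_def
    by (rule reaches_cost, rule reaches_Seq, rule reaches_RSet, rule reaches_Seq, rule reaches_ISet)
      (use loop f in auto)
qed

definition dot_loop :: prog where
  "dot_loop = For 20 (reg 0) (Seq
     (RSet (reg 18) (RAdd (RMem (reg 18)) (RMul (RMem (IAdd (reg 21) (reg 20))) (RMem (reg 22)))))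
     (ISet (IConst 22) (IAdd (reg 22) (reg 0))))"

lemma reaches_dot_loop:
  assumes "f 0 = d" and "\<forall>l<d. f 21 + l < f 18" "\<forall>l<d. f 22 + l * d < f 18"
  shows "reaches dot_loop f g 60 (Suc d) (\<lambda>f' g'. keeps 20 f f' \<and> f' 21 = f 21 \<and>
    g' = g(f 18 := g (f 18) + (\<Sum>l<d. g (f 21 + l) * g (f 22 + l * d))))"
proof -
  let ?body = "Seq
     (RSet (reg 18) (RAdd (RMem (reg 18)) (RMul (RMem (IAdd (reg 21) (reg 20))) (RMem (reg 22)))))
     (ISet (IConst 22) (IAdd (reg 22) (reg 0)))"
  let ?I = "\<lambda>i f' g'. keeps 20 f f' \<and> f' 21 = f 21 \<and> f' 22 = f 22 + i * d \<and>
    g' = g(f 18 := g (f 18) + (\<Sum>l<i. g (f 21 + l) * g (f 22 + l * d)))"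
  have "reaches (For 20 (reg 0) ?body) f g (30 + 2 * icost (reg 0) + 15) (1 * Suc d)
    (\<lambda>f' g'. keeps 20 f f' \<and> f' 21 = f 21 \<and>
      g' = g(f 18 := g (f 18) + (\<Sum>l<d. g (f 21 + l) * g (f 22 + l * d))))"
  proof (rule reaches_For[where n = d and I = ?I])
    fix i f' g' assume i: "i < d" "?I i f' g'" "f' 20 = i"
    with assms have "f 21 + i < f 18" "f 22 + i * d < f 18" by auto
    with i assms(1)
    show "reaches ?body f' g' 30 1 (\<lambda>f'' g''. f'' 20 = i \<and> ?I (Suc i) (f''(20 := Suc i)) g'')"
      by - (rule reaches_cost, (rule reaches_Seq reaches_ISet reaches_RSet)+, auto simp: keeps_def fun_upd_def)
  qed (use assms in \<open>auto simp: keeps_def\<close>)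
  then show ?thesis unfolding dot_loop_def by (rule reaches_time) auto
qed

definition row_loop :: prog where
  "row_loop = For 19 (reg 0) (Seq (RSet (reg 18) (RConst 0))
     (Seq (ISet (IConst 22) (IAdd (reg 14) (reg 19))) (Seq dot_loop
       (ISet (IConst 18) (IAdd (reg 18) (IConst 1))))))"

lemma reaches_row_loop:
  assumes f: "f 0 = d" "f 21 + d \<le> f 18" "f 14 + d * d \<le> f 18"
  shows "reaches row_loop f g 200 (Suc d ^ 2) (\<lambda>f' g'. keeps 18 f f' \<and> f' 21 = f 21 \<and>
    f' 18 = f 18 + d \<and> keeps (f 18) g g' \<and>
    (\<forall>c<d. g' (f 18 + c) = (\<Sum>l<d. g (f 21 + l) * g (f 14 + l * d + c))))"
proof -
  let ?body = "Seq (RSet (reg 18) (RConst 0)) (Seq (ISet (IConst 22) (IAdd (reg 14) (reg 19)))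
     (Seq dot_loop (ISet (IConst 18) (IAdd (reg 18) (IConst 1)))))"
  let ?s = "\<lambda>c. \<Sum>l<d. g (f 21 + l) * g (f 14 + l * d + c)"
  let ?I = "\<lambda>i f' g'. keeps 18 f f' \<and> f' 21 = f 21 \<and> f' 18 = f 18 + i \<and> keeps (f 18) g g' \<and>
    (\<forall>c<i. g' (f 18 + c) = ?s c)"
  have "reaches (For 19 (reg 0) ?body) f g (100 + 2 * icost (reg 0) + 15) (Suc d * Suc d)
    (\<lambda>f' g'. keeps 18 f f' \<and> f' 21 = f 21 \<and> f' 18 = f 18 + d \<and> keeps (f 18) g g' \<and>
      (\<forall>c<d. g' (f 18 + c) = ?s c))"
  proof (rule reaches_For[where n = d and I = ?I])
    fix i f' g' assume i: "i < d" "?I i f' g'" "f' 19 = i"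
    have lt: "f 14 + (l * d + i) < f 18" if "l < d" for l
      using row_major_less[OF that i(1)] f(3) by linarith
    let ?f = "f'(22 := f 14 + i)" and ?g = "g'(f 18 + i := 0)"
    have sum: "(\<Sum>l<d. ?g (f 21 + l) * ?g (f 14 + i + l * d)) = ?s i"
    proof (rule sum.cong[OF refl])
      fix l assume "l \<in> {..<d}"
      then have "f 21 + l < f 18" "f 14 + l * d + i < f 18"
        using lt[of l] f(2) by auto
      with i show "?g (f 21 + l) * ?g (f 14 + i + l * d) = g (f 21 + l) * g (f 14 + l * d + i)"
        by (simp add: keeps_def add.assoc add.commute[of i])
    qed
    have dot: "reaches dot_loop ?f ?g 60 (Suc d) (\<lambda>f'' g''. keeps 20 ?f f'' \<and>
        f'' 21 = f 21 \<and> g'' = g'(f 18 + i := ?s i))"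
    proof (rule reaches_weaken)
      have eqs: "?f 18 = f 18 + i" "?f 21 = f 21" "?f 22 = f 14 + i" "?f 0 = d"
        using i f by (auto simp: keeps_def)
      have less: "f 21 + l < f 18 + i" "f 14 + i + l * d < f 18 + i" if "l < d" for l
        using lt[OF that] f(2) that by auto
      show "reaches dot_loop ?f ?g 60 (Suc d) (\<lambda>f'' g''. keeps 20 ?f f'' \<and> f'' 21 = ?f 21 \<and>
          g'' = ?g(?f 18 := ?g (?f 18) + (\<Sum>l<d. ?g (?f 21 + l) * ?g (?f 22 + l * d))))"
        using less by (intro reaches_dot_loop; simp only: eqs) auto
      fix f'' g'' assume *: "keeps 20 ?f f'' \<and> f'' 21 = ?f 21 \<and>
          g'' = ?g(?f 18 := ?g (?f 18) + (\<Sum>l<d. ?g (?f 21 + l) * ?g (?f 22 + l * d)))"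
      then have "g'' = ?g(f 18 + i := ?g (f 18 + i) + ?s i)"
        unfolding eqs sum by blast
      with * eqs(2) show "keeps 20 ?f f'' \<and> f'' 21 = f 21 \<and> g'' = g'(f 18 + i := ?s i)"
        by simp
    qed auto
    have "reaches (Seq dot_loop (ISet (IConst 18) (IAdd (reg 18) (IConst 1)))) ?f ?g (60 + 20) (Suc d)
        (\<lambda>f'' g''. f'' 19 = i \<and> ?I (Suc i) (f''(19 := Suc i)) g'')"
      by (rule reaches_then[OF dot], rule reaches_cost, rule reaches_ISet)
        (use i in \<open>auto simp: keeps_def less_Suc_eq\<close>)
    with i f show "reaches ?body f' g' 100 (Suc d)
        (\<lambda>f'' g''. f'' 19 = i \<and> ?I (Suc i) (f''(19 := Suc i)) g'')"
      by - (rule reaches_cost, rule reaches_Seq, rule reaches_RSet, rule reaches_Seq, rule reaches_ISet, auto simp: keeps_def)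
  qed (use f in \<open>auto simp: keeps_def\<close>)
  then show ?thesis unfolding row_loop_def by (rule reaches_time) (auto simp: power2_eq_square)
qed

definition mat_mult :: prog where
  "mat_mult = Seq (ISet (IConst 18) (reg 15)) (Seq (ISet (IConst 21) (reg 5))
     (For 17 (reg 0) (Seq row_loop (ISet (IConst 21) (IAdd (reg 21) (reg 0))))))"

lemma reaches_mat_mult:
  assumes f: "f 0 = d" "f 5 + d * d \<le> f 15" "f 14 + d * d \<le> f 15"
    and M: "block d g (f 5) M" and N: "block d g (f 14) N"
  shows "reaches mat_mult f g 300 (Suc d ^ 3) (\<lambda>f' g'. keeps 17 f f' \<and> keeps (f 15) g g' \<and>
    block d g' (f 15) (\<lambda>r c. \<Sum>l<d. M r l * N l c))"
proof -
  let ?body = "Seq row_loop (ISet (IConst 21) (IAdd (reg 21) (reg 0)))"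
  let ?P = "\<lambda>r c. \<Sum>l<d. M r l * N l c"
  let ?I = "\<lambda>i f' g'. keeps 17 f f' \<and> f' 18 = f 15 + i * d \<and> f' 21 = f 5 + i * d \<and>
    keeps (f 15) g g' \<and> (\<forall>r<i. \<forall>c<d. g' (f 15 + r * d + c) = ?P r c)"
  have loop: "reaches (For 17 (reg 0) ?body) (f(18 := f 15, 21 := f 5)) g
    (220 + 2 * icost (reg 0) + 15) (Suc d ^ 2 * Suc d)
    (\<lambda>f' g'. keeps 17 f f' \<and> keeps (f 15) g g' \<and> block d g' (f 15) ?P)"
  proof (rule reaches_For[where n = d and I = ?I])
    fix i f' g' assume i: "i < d" "?I i f' g'" "f' 17 = i"
    have "f 5 + i * d + d \<le> f 15"
      using f(2) i(1) mult_le_mono1[of "Suc i" d d] by simp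
    moreover have M': "g' (f 5 + i * d + l) = M i l" if "l < d" for l
      using M i f(2) that row_major_less[of i d l d] by (simp add: keeps_def blockD)
    moreover have N': "g' (f 14 + l * d + c) = N l c" if "l < d" "c < d" for l c
      using N i f(3) that row_major_less[of l d c d] by (simp add: keeps_def blockD)
    ultimately have row: "reaches row_loop f' g' 200 (Suc d ^ 2) (\<lambda>f'' g''. keeps 18 f' f'' \<and>
        f'' 21 = f 5 + i * d \<and> f'' 18 = f 15 + i * d + d \<and> keeps (f 15 + i * d) g' g'' \<and>
        (\<forall>c<d. g'' (f 15 + i * d + c) = ?P i c))"
      using f i by (intro reaches_weaken[OF reaches_row_loop[where d = d]]) (auto simp: keeps_def)
    show "reaches ?body f' g' 220 (Suc d ^ 2)
        (\<lambda>f'' g''. f'' 17 = i \<and> ?I (Suc i) (f''(17 := Suc i)) g'')"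
    proof (rule reaches_cost, rule reaches_then[OF row])
      fix f'' g''
      assume h: "keeps 18 f' f'' \<and> f'' 21 = f 5 + i * d \<and> f'' 18 = f 15 + i * d + d \<and>
        keeps (f 15 + i * d) g' g'' \<and> (\<forall>c<d. g'' (f 15 + i * d + c) = ?P i c)"
      have "g'' (f 15 + r * d + c) = ?P r c" if "r < Suc i" "c < d" for r c
      proof (cases "r = i")
        case False
        with that have "r < i" by simp
        with h i that row_major_less[of r i c d] show ?thesis by (simp add: keeps_def)
      qed (use h that in simp)
      moreover have "keeps (f 15) g g''" "keeps 17 f f''" using h i by (auto simp: keeps_def)
      moreover have "f'' 17 = i" "f'' 0 = d" using h i f by (auto simp: keeps_def)
      ultimately show "reaches (ISet (IConst 21) (IAdd (reg 21) (reg 0))) f'' g'' 10 (Suc d ^ 2)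
          (\<lambda>f'' g''. f'' 17 = i \<and> ?I (Suc i) (f''(17 := Suc i)) g'')"
        using h by - (rule reaches_cost, rule reaches_ISet, auto)
    qed simp
  qed (use f in \<open>auto simp: keeps_def block_def\<close>)
  show ?thesis
    unfolding mat_mult_def
    by (rule reaches_cost, rule reaches_Seq, rule reaches_ISet, rule reaches_Seq, rule reaches_ISet)
      (use loop f in \<open>auto simp: power3_eq_cube power2_eq_square mult.assoc\<close>)
qed

definition subtract :: prog where
  "subtract = Seq (ISet (IConst 18) (IConst 0))
     (Seq (For 17 (reg 3) (ISet (IConst 18) (IAdd (reg 18) (reg 12))))
       (For 17 (reg 3) (RSet (IAdd (reg 5) (reg 17))
         (RSub (RMem (IAdd (reg 5) (reg 17))) (RMem (IAdd (reg 18) (reg 17)))))))"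

lemma reaches_subtract:
  assumes f: "f 3 = d * d" "f 12 * (d * d) + d * d \<le> f 5"
    and M: "block d g (f 5) M" and A: "block d g (f 12 * (d * d)) A"
  shows "reaches subtract f g 200 (Suc d ^ 2) (\<lambda>f' g'. keeps 17 f f' \<and> keeps (f 5) g g' \<and>
    block d g' (f 5) (\<lambda>r c. M r c - A r c))"
proof -
  let ?a = "f 12 * (d * d)"
  have "reaches (For 17 (reg 3) (ISet (IConst 18) (IAdd (reg 18) (reg 12)))) (f(18 := 0)) g
      (10 + 2 * icost (reg 3) + 15) (1 * Suc d ^ 2)
      (\<lambda>f' g'. keeps 17 f f' \<and> f' 18 = ?a \<and> g' = g)"
  proof (rule reaches_For[where n = "d * d" and
        I = "\<lambda>i f' g'. keeps 17 f f' \<and> f' 18 = f 12 * i \<and> g' = g"])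
    fix i f' g' assume "keeps 17 f f' \<and> f' 18 = f 12 * i \<and> g' = g" "f' 17 = i"
    then show "reaches (ISet (IConst 18) (IAdd (reg 18) (reg 12))) f' g' 10 1 (\<lambda>f'' g''.
        f'' 17 = i \<and> keeps 17 f (f''(17 := Suc i)) \<and> (f''(17 := Suc i)) 18 = f 12 * Suc i \<and> g'' = g)"
      by - (rule reaches_cost, rule reaches_ISet, auto simp: keeps_def)
  qed (use f in \<open>auto simp: keeps_def power2_eq_square\<close>)
  note offset = reaches_time[OF this, of 50 "Suc d ^ 2"]
  have minus: "reaches (For 17 (reg 3) (RSet (IAdd (reg 5) (reg 17))
         (RSub (RMem (IAdd (reg 5) (reg 17))) (RMem (IAdd (reg 18) (reg 17)))))) f0 g0 100 (Suc d ^ 2)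
      (\<lambda>f' g'. keeps 17 f f' \<and> keeps (f 5) g g' \<and> block d g' (f 5) (\<lambda>r c. M r c - A r c))"
    if f0: "keeps 17 f f0 \<and> f0 18 = ?a \<and> g0 = g" for f0 g0
  proof (rule reaches_weaken)
    let ?I = "\<lambda>i f' g'. keeps 17 f f' \<and> f' 18 = ?a \<and>
        g' = (\<lambda>x. if f 5 \<le> x \<and> x < f 5 + i then g x - g (?a + (x - f 5)) else g x)"
    show "reaches (For 17 (reg 3) (RSet (IAdd (reg 5) (reg 17))
         (RSub (RMem (IAdd (reg 5) (reg 17))) (RMem (IAdd (reg 18) (reg 17)))))) f0 g0
      (25 + 2 * icost (reg 3) + 15) (1 * Suc d ^ 2) (?I (d * d))"
    proof (rule reaches_For[where n = "d * d" and I = ?I])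
      fix i f' g' assume i: "i < d * d" "?I i f' g'" "f' 17 = i"
      with f have "?a + i < f 5" by linarith
      with i show "reaches (RSet (IAdd (reg 5) (reg 17))
         (RSub (RMem (IAdd (reg 5) (reg 17))) (RMem (IAdd (reg 18) (reg 17))))) f' g' 25 1
         (\<lambda>f'' g''. f'' 17 = i \<and> ?I (Suc i) (f''(17 := Suc i)) g'')"
        by - (rule reaches_cost, rule reaches_RSet, auto simp: keeps_def fun_eq_iff)
    qed (use f f0 in \<open>auto simp: keeps_def power2_eq_square fun_eq_iff\<close>)
    fix f' g' assume *: "?I (d * d) f' g'"
    have "g' (f 5 + r * d + c) = M r c - A r c" if "r < d" "c < d" for r c
      using * row_major_less[OF that] blockD[OF M that] blockD[OF A that] by (simp add: add.assoc)
    moreover have "keeps (f 5) g g'" using * by (simp add: keeps_def)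
    ultimately show "keeps 17 f f' \<and> keeps (f 5) g g' \<and> block d g' (f 5) (\<lambda>r c. M r c - A r c)"
      using * by (simp add: block_def)
  qed auto
  show ?thesis
    unfolding subtract_def
    by (rule reaches_cost, rule reaches_Seq, rule reaches_ISet, simp,
        rule reaches_then[OF offset minus]) auto
qed

definition divmod :: prog where
  "divmod = Seq (ISet (IConst 13) (IConst 0))
     (While (ILess (reg 6) (IAdd (reg 9) (IConst 1)))
       (Seq (ISet (IConst 9) (ISub (reg 9) (reg 6))) (ISet (IConst 13) (IAdd (reg 13) (IConst 1)))))"

lemma reaches_divmod:
  assumes "0 < f 6" "f 9 < n"
  shows "reaches divmod f g 100 n
    (\<lambda>f' g'. f' = f(9 := f 9 mod f 6, 13 := f 9 div f 6) \<and> g' = g)"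
proof -
  let ?q = "f 9" and ?b = "f 6"
  let ?body = "Seq (ISet (IConst 9) (ISub (reg 9) (reg 6))) (ISet (IConst 13) (IAdd (reg 13) (IConst 1)))"
  let ?test = "ILess (reg 6) (IAdd (reg 9) (IConst 1))"
  have "reaches (While ?test ?body) (f(13 := 0)) g (25 + 2 * tcost ?test) (1 * n)
    (\<lambda>f' g'. f' = f(9 := ?q mod ?b, 13 := ?q div ?b) \<and> g' = g)"
  proof (rule reaches_While[where n = "?q div ?b" and
        I = "\<lambda>i f' g'. f' = f(9 := ?q - i * ?b, 13 := i) \<and> g' = g"])
    fix i f' g'
    assume i: "i < ?q div ?b" "f' = f(9 := ?q - i * ?b, 13 := i) \<and> g' = g"
    have "Suc i * ?b \<le> ?q"
      using i(1) mult_le_mono1[of "Suc i" "?q div ?b" ?b] div_times_less_eq_dividend[of ?q ?b] by linarith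
    then have "holds ?test (f', g')" using i(2) by simp
    moreover have "reaches ?body f' g' 25 1 (\<lambda>f' g'. f' = f(9 := ?q - Suc i * ?b, 13 := Suc i) \<and> g' = g)"
      using i(2) by - (rule reaches_cost, (rule reaches_Seq reaches_ISet)+, auto simp: fun_eq_iff)
    ultimately show "holds ?test (f', g') \<and>
        reaches ?body f' g' 25 1 (\<lambda>f' g'. f' = f(9 := ?q - Suc i * ?b, 13 := Suc i) \<and> g' = g)"
      by blast
  next
    fix f' g' assume *: "f' = f(9 := ?q - ?q div ?b * ?b, 13 := ?q div ?b) \<and> g' = g"
    have "?q - ?q div ?b * ?b = ?q mod ?b" by (simp add: minus_div_mult_eq_mod)
    with * mod_less_divisor[OF assms(1), of ?q]
    show "\<not> holds ?test (f', g') \<and> f' = f(9 := ?q mod ?b, 13 := ?q div ?b) \<and> g' = g"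
      by simp
  next
    show "?q div ?b \<le> n" using assms(2) div_le_dividend[of ?q ?b] by linarith
  qed (use assms in \<open>auto simp: fun_eq_iff\<close>)
  then show ?thesis
    unfolding divmod_def
    by - (rule reaches_cost, rule reaches_Seq, rule reaches_ISet, use assms in auto)
qed

definition fl_step :: prog where
  "fl_step = Seq mat_mult (Seq trace
    (Seq (RSet (scalar 3) (RAdd (RMem (scalar 3)) (RConst 1)))
    (Seq (RSet (scalar 2) (RDiv (RMem (scalar 2)) (RMem (scalar 3))))
    (Seq (add_diag 15 (RMem (scalar 2)))
    (Seq (ISet (IConst 14) (reg 15)) (ISet (IConst 15) (IAdd (reg 15) (reg 3))))))))"

definition fl_inv :: "nat \<Rightarrow> (nat \<Rightarrow> nat \<Rightarrow> real) \<Rightarrow> (nat \<Rightarrow> nat) \<Rightarrow> (nat \<Rightarrow> real) \<Rightarrow>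
    nat \<Rightarrow> (nat \<Rightarrow> nat) \<Rightarrow> (nat \<Rightarrow> real) \<Rightarrow> bool" where
  "fl_inv d M f0 g0 j f g \<longleftrightarrow> keeps 14 f0 f \<and> f 14 = f 5 + Suc j * (d * d) \<and>
     f 15 = f 14 + d * d \<and> keeps (f 4 + 2) g0 g \<and> block d g (f 5) M \<and>
     block d g (f 14) (fl_mat d M j) \<and> g (f 4 + 2) = fl_coeff d M j \<and> g (f 4 + 3) = real j"

lemma reaches_fl_step:
  assumes f: "f 0 = d" "f 3 = d * d" "f 5 = f 4 + 4" and inv: "fl_inv d M f0 g0 j f g"
  shows "reaches fl_step f g 700 (Suc d ^ 3) (\<lambda>f' g'. keeps 14 f f' \<and> f' 16 = f 16 \<and>
    fl_inv d M f0 g0 (Suc j) f' g')"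
proof -
  let ?P = "\<lambda>r c. \<Sum>l<d. M r l * fl_mat d M j l c"
  let ?X = "Suc d ^ 3" and ?B = "f 4"
  have X: "Suc d \<le> ?X" "0 < ?X" by (simp_all add: self_le_power)
  note inv = inv[unfolded fl_inv_def]
  have 1: "reaches mat_mult f g 300 ?X (\<lambda>f1 g1. keeps 17 f f1 \<and> keeps (f 15) g g1 \<and>
      block d g1 (f 15) ?P)"
    using f inv by (intro reaches_mat_mult) auto
  have "reaches (Seq trace (Seq (RSet (scalar 3) (RAdd (RMem (scalar 3)) (RConst 1)))
      (Seq (RSet (scalar 2) (RDiv (RMem (scalar 2)) (RMem (scalar 3))))
      (Seq (add_diag 15 (RMem (scalar 2)))
      (Seq (ISet (IConst 14) (reg 15)) (ISet (IConst 15) (IAdd (reg 15) (reg 3)))))))) f1 g1 400 ?X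
      (\<lambda>f' g'. keeps 14 f f' \<and> f' 16 = f 16 \<and> fl_inv d M f0 g0 (Suc j) f' g')"
    if h1: "keeps 17 f f1 \<and> keeps (f 15) g g1 \<and> block d g1 (f 15) ?P" for f1 g1
  proof (rule reaches_cost, rule reaches_then)
    have f1: "f1 0 = d" "f1 3 = d * d" "f1 4 = ?B" "f1 15 = f 15"
      using h1 f by (auto simp: keeps_def)
    show "reaches trace f1 g1 100 ?X (\<lambda>f2 g2. keeps 17 f1 f2 \<and> g2 = g1(?B + 2 := - (\<Sum>i<d. ?P i i)))"
      using reaches_time[OF reaches_trace[of f1 d g1 ?P] _ X(1)] h1 f1 f inv by auto
    fix f2 g2 assume h2: "keeps 17 f1 f2 \<and> g2 = g1(?B + 2 := - (\<Sum>i<d. ?P i i))"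
    have f2: "f2 0 = d" "f2 3 = d * d" "f2 4 = ?B" "f2 15 = f 15" "f2 5 = f 5" "f2 16 = f 16"
      using h1 h2 f by (auto simp: keeps_def)
    have keep2: "keeps 14 f f2" using h1 h2 by (auto simp: keeps_def)
    define x where "x = fl_coeff d M (Suc j)"
    define g4 where "g4 = g2(?B + 3 := real (Suc j), ?B + 2 := x)"
    have g2: "g2 (?B + 3) = real j"
      using h1 h2 inv f by (auto simp: keeps_def)
    have low: "keeps (?B + 2) g g4" and high: "\<And>a. ?B + 4 \<le> a \<Longrightarrow> g4 a = g1 a"
      using h1 h2 f inv by (auto simp: keeps_def g4_def)
    have P4: "block d g4 (f 15) ?P"
      using h1 f inv by (simp add: block_def high)
    have M4: "block d g4 (f 5) M"
      unfolding block_def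
    proof (intro allI impI)
      fix r c assume rc: "r < d" "c < d"
      have "g1 (f 5 + r * d + c) = g (f 5 + r * d + c)"
        using row_major_less[OF rc] h1 inv by (simp add: keeps_def)
      then show "g4 (f 5 + r * d + c) = M r c"
        using rc inv f by (simp add: high blockD)
    qed
    have diag: "reaches (add_diag 15 (RMem (scalar 2))) f2 g4 100 ?X
        (\<lambda>f5 g5. keeps 17 f2 f5 \<and> keeps (f2 15) g4 g5 \<and>
          block d g5 (f2 15) (\<lambda>r c. ?P r c + (if r = c then x else 0)))"
      using f2 f inv P4
      by (intro reaches_time[OF reaches_add_diag _ X(1)]) (auto simp: keeps_def g4_def)
    have eq: "(\<lambda>r c. ?P r c + (if r = c then x else 0)) = fl_mat d M (Suc j)"
      by (auto simp: x_def fun_eq_iff)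
    have last: "reaches (Seq (ISet (IConst 14) (reg 15)) (ISet (IConst 15) (IAdd (reg 15) (reg 3))))
        f5 g5 20 ?X
        (\<lambda>f' g'. keeps 14 f f' \<and> f' 16 = f 16 \<and> fl_inv d M f0 g0 (Suc j) f' g')"
      if h5: "keeps 17 f2 f5 \<and> keeps (f2 15) g4 g5 \<and> block d g5 (f2 15) (fl_mat d M (Suc j))"
      for f5 g5
    proof -
      have f5: "f5 3 = d * d" "f5 4 = ?B" "f5 15 = f 15" "f5 5 = f 5" "f5 16 = f 16"
        using h5 f2 by (auto simp: keeps_def)
      have "keeps 14 f f5" using keep2 h5 by (auto simp: keeps_def)
      moreover have "keeps 14 f0 f5" using inv keep2 h5 by (auto simp: keeps_def)
      moreover have "keeps (?B + 2) g0 g5" using inv low h5 f f2 by (auto simp: keeps_def)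
      moreover have "block d g5 (f 5) M"
        using block_keeps[OF M4, of "f 15"] h5 f2 inv by auto
      moreover have "g5 (?B + 2) = x" "g5 (?B + 3) = real (Suc j)"
        using h5 f2 inv f by (auto simp: keeps_def g4_def)
      moreover have "f 15 = f 5 + Suc (Suc j) * (d * d)" using inv by simp
      ultimately show ?thesis
        using h5 f2 f5 X(2)
        by - (rule reaches_cost, (rule reaches_Seq reaches_ISet)+, auto simp: fl_inv_def x_def)
    qed
    have g4_eq: "g4 = g2(?B + 3 := g2 (?B + 3) + 1,
        ?B + 2 := g2 (?B + 2) / (g2 (?B + 3) + 1))"
      using g2 h2 by (auto simp: g4_def x_def)
    show "reaches (Seq (RSet (scalar 3) (RAdd (RMem (scalar 3)) (RConst 1)))
      (Seq (RSet (scalar 2) (RDiv (RMem (scalar 2)) (RMem (scalar 3))))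
      (Seq (add_diag 15 (RMem (scalar 2)))
      (Seq (ISet (IConst 14) (reg 15)) (ISet (IConst 15) (IAdd (reg 15) (reg 3))))))) f2 g2 200 ?X
      (\<lambda>f' g'. keeps 14 f f' \<and> f' 16 = f 16 \<and> fl_inv d M f0 g0 (Suc j) f' g')"
      by (rule reaches_cost, rule reaches_Seq, rule reaches_RSet, rule reaches_Seq, rule reaches_RSet)
        (use f2 X reaches_then[OF diag[unfolded eq] last] in \<open>auto simp: g4_eq\<close>)
  qed simp
  from reaches_then[OF 1 this] show ?thesis
    unfolding fl_step_def by (rule reaches_cost) auto
qed

definition char_coeff :: prog where
  "char_coeff = Seq (ISet (IConst 14) (IAdd (reg 5) (reg 3)))
    (Seq (ISet (IConst 15) (IAdd (reg 14) (reg 3)))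
    (Seq (RSet (scalar 2) (RConst 1)) (Seq (RSet (scalar 3) (RConst 0))
    (Seq (clear 14) (Seq (add_diag 14 (RConst 1)) (For 16 (reg 2) fl_step))))))"

lemma reaches_char_coeff:
  assumes f: "f 0 = d" "f 2 = k" "f 3 = d * d" "f 5 = f 4 + 4" and k: "k \<le> d"
    and M: "block d g (f 5) M"
  shows "reaches char_coeff f g 1000 (Suc d ^ 4) (\<lambda>f' g'. keeps 14 f f' \<and>
    keeps (f 4 + 2) g g' \<and> g' (f 4 + 2) = fl_coeff d M k)"
proof -
  let ?X = "Suc d ^ 4"
  have "Suc d ^ 3 * Suc d = ?X" by (simp only: power4_eq_xxxx power3_eq_cube)
  then have X: "Suc d ^ 3 * Suc d \<le> ?X" "Suc d ^ 2 \<le> ?X" "Suc d \<le> ?X" "0 < ?X"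
    by (simp_all only: order.refl) (simp_all add: power_increasing self_le_power)
  define f1 where "f1 = f(14 := f 5 + d * d, 15 := f 5 + d * d + d * d)"
  define g1 where "g1 = g(f 4 + 2 := 1, f 4 + 3 := 0)"
  have f1: "f1 0 = d" "f1 2 = k" "f1 3 = d * d" "f1 4 = f 4" "f1 5 = f 5" "f1 14 = f 5 + d * d"
    "f1 15 = f 5 + d * d + d * d" "keeps 14 f f1"
    using f by (auto simp: f1_def)
  have g1: "keeps (f 4 + 2) g g1" "block d g1 (f 5) M" "g1 (f 4 + 2) = 1" "g1 (f 4 + 3) = 0"
    using M f by (auto simp: g1_def block_def)
  have clear: "reaches (clear 14) f1 g1 50 ?X (\<lambda>f2 g2. keeps 17 f1 f2 \<and> keeps (f1 14) g1 g2 \<and>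
      block d g2 (f1 14) (\<lambda>r c. 0))"
    using f1 by (intro reaches_time[OF reaches_clear _ X(2)]) auto
  have diag: "reaches (add_diag 14 (RConst 1)) f2 g2 100 ?X (\<lambda>f3 g3. keeps 17 f1 f3 \<and>
      keeps (f1 14) g1 g3 \<and> block d g3 (f1 14) (fl_mat d M 0))"
    if h: "keeps 17 f1 f2 \<and> keeps (f1 14) g1 g2 \<and> block d g2 (f1 14) (\<lambda>r c. 0)" for f2 g2
  proof (rule reaches_weaken)
    have "f2 14 = f1 14" "f2 0 = d" using h f1 by (auto simp: keeps_def)
    with h show "reaches (add_diag 14 (RConst 1)) f2 g2 100 (Suc d) (\<lambda>f3 g3. keeps 17 f2 f3 \<and>
      keeps (f2 14) g2 g3 \<and> block d g3 (f2 14) (\<lambda>r c. 0 + (if r = c then 1 else 0)))"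
      by (intro reaches_add_diag) auto
    fix f3 g3 assume "keeps 17 f2 f3 \<and> keeps (f2 14) g2 g3 \<and>
      block d g3 (f2 14) (\<lambda>r c. 0 + (if r = c then 1 else 0))"
    with h \<open>f2 14 = f1 14\<close>
    show "keeps 17 f1 f3 \<and> keeps (f1 14) g1 g3 \<and> block d g3 (f1 14) (fl_mat d M 0)"
      by (auto simp: keeps_def block_def)
  qed (use X in auto)
  have loop: "reaches (For 16 (reg 2) fl_step) f3 g3 (700 + 2 * icost (reg 2) + 15) (Suc d ^ 3 * Suc d)
      (\<lambda>f' g'. keeps 14 f f' \<and> keeps (f 4 + 2) g g' \<and> g' (f 4 + 2) = fl_coeff d M k)"
    if h: "keeps 17 f1 f3 \<and> keeps (f1 14) g1 g3 \<and> block d g3 (f1 14) (fl_mat d M 0)" for f3 g3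
  proof (rule reaches_For[where n = k and I = "fl_inv d M f1 g"])
    have "f3 14 = f1 14" "f3 15 = f1 15" "f3 4 = f 4" "f3 5 = f 5" "keeps 14 f1 f3"
      using h f1 by (auto simp: keeps_def)
    moreover have "keeps (f 4 + 2) g g3" "g3 (f 4 + 2) = 1" "g3 (f 4 + 3) = 0"
      using h g1 f f1 by (auto simp: keeps_def)
    moreover have "block d g3 (f 5) M"
      using block_keeps[OF g1(2), of "f1 14"] h f1 by auto
    ultimately show "fl_inv d M f1 g 0 (f3(16 := 0)) g3"
      using h f1 by (simp add: fl_inv_def)
  next
    fix j f' g' assume j: "j < k" "fl_inv d M f1 g j f' g'" "f' 16 = j"
    then have "f' 0 = d" "f' 3 = d * d" "f' 5 = f' 4 + 4"
      using f1 f by (auto simp: fl_inv_def keeps_def)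
    from reaches_fl_step[OF this j(2)]
    show "reaches fl_step f' g' 700 (Suc d ^ 3)
        (\<lambda>f' g'. f' 16 = j \<and> fl_inv d M f1 g (Suc j) (f'(16 := Suc j)) g')"
      by (rule reaches_weaken) (use j in \<open>auto simp: fl_inv_def\<close>)
  next
    fix f' g' assume "fl_inv d M f1 g k f' g'"
    moreover from this have "f' 4 = f 4" using f1 by (auto simp: fl_inv_def keeps_def)
    ultimately show "keeps 14 f f' \<and> keeps (f 4 + 2) g g' \<and> g' (f 4 + 2) = fl_coeff d M k"
      using f1(8) by (auto simp: fl_inv_def keeps_def)
  qed (use k f1 in \<open>auto simp: fl_inv_def keeps_def\<close>)
  have rest: "reaches (Seq (clear 14) (Seq (add_diag 14 (RConst 1)) (For 16 (reg 2) fl_step))) f1 g1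
      900 ?X (\<lambda>f' g'. keeps 14 f f' \<and> keeps (f 4 + 2) g g' \<and> g' (f 4 + 2) = fl_coeff d M k)"
    by (rule reaches_cost, rule reaches_then[OF clear], rule reaches_then[OF diag], assumption,
        rule reaches_time[OF loop _ X(1)]) auto
  show ?thesis
    unfolding char_coeff_def
    by (rule reaches_cost, rule reaches_Seq, rule reaches_ISet, rule reaches_Seq, rule reaches_ISet,
        rule reaches_Seq, rule reaches_RSet, rule reaches_Seq, rule reaches_RSet)
      (use rest f X in \<open>auto simp: f1_def g1_def\<close>)
qed

definition digit_step :: prog where
  "digit_step = Seq divmod
    (Seq (If (ILess (reg 9) (reg 1))
       (Seq (ISet (IConst 12) (reg 9))
         (Seq (RSet (scalar 1) (RSub (RConst 0) (RMem (scalar 1)))) subtract))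
       (ISet (IConst 12) (ISub (reg 9) (reg 1))))
    (Seq (If (ILess (reg 12) (reg 10)) (RSet (scalar 1) (RConst 0)) Skip)
    (Seq (ISet (IConst 10) (IAdd (reg 12) (IConst 1))) (ISet (IConst 9) (reg 13)))))"

lemma reaches_digit_step:
  assumes f: "f 1 = m" "f 3 = d * d" "f 4 = m * (d * d)" "f 5 = f 4 + 4" "f 6 = 2 * m"
    and "0 < m" "f 9 < n"
    and A: "\<And>i. i < m \<Longrightarrow> block d g (i * (d * d)) (\<lambda>r c. A i $$ (r, c))"
    and M: "block d g (f 5) M"
  defines "a \<equiv> f 9 mod (2 * m)"
  shows "reaches digit_step f g 500 (n * Suc d ^ 2) (\<lambda>f' g'. keeps 9 f f' \<and> f' 11 = f 11 \<and>
    f' 9 = f 9 div (2 * m) \<and> f' 10 = Suc (digit_elem m a) \<and> keeps (f 4 + 1) g g' \<and>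
    g' (f 4 + 1) = digit_sign m (f 10) a (g (f 4 + 1)) \<and> block d g' (f 5) (digit_matrix m A a M))"
proof -
  let ?X = "n * Suc d ^ 2" and ?B = "f 4"
  have "0 < n" using assms(7) by simp
  then have X: "0 < ?X" "n \<le> ?X" "Suc d ^ 2 \<le> ?X" by simp_all
  define f1 where "f1 = f(9 := a, 13 := f 9 div (2 * m))"
  have div: "reaches divmod f g 100 ?X (\<lambda>f' g'. f' = f1 \<and> g' = g)"
    using reaches_time[OF reaches_divmod[of f n g] _ X(2)] assms by (simp add: f1_def)
  let ?Q = "\<lambda>f' g'. keeps 9 f f' \<and> f' 10 = f 10 \<and> f' 11 = f 11 \<and> f' 12 = digit_elem m a \<and>
    f' 13 = f 9 div (2 * m) \<and> keeps (?B + 1) g g' \<and>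
    g' (?B + 1) = (if a < m then - g (?B + 1) else g (?B + 1)) \<and>
    block d g' (f 5) (digit_matrix m A a M)"
  have branch: "reaches (If (ILess (reg 9) (reg 1))
       (Seq (ISet (IConst 12) (reg 9))
         (Seq (RSet (scalar 1) (RSub (RConst 0) (RMem (scalar 1)))) subtract))
       (ISet (IConst 12) (ISub (reg 9) (reg 1)))) f1 g (5 + max 250 10) ?X ?Q"
  proof (rule reaches_cost[OF reaches_If])
    assume "holds (ILess (reg 9) (reg 1)) (f1, g)"
    then have a: "a < m" using f by (simp add: f1_def)
    define f2 where "f2 = f1(12 := a)"
    define g2 where "g2 = g(?B + 1 := - g (?B + 1))"
    have f2: "f2 3 = d * d" "f2 12 = a" "f2 5 = f 5" using f by (simp_all add: f2_def f1_def)
    have "a * (d * d) + d * d \<le> m * (d * d)" using mult_le_mono1[of "Suc a" m "d * d"] a by simp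
    then have le: "a * (d * d) + d * d \<le> ?B" using f by simp
    have A2: "block d g2 (a * (d * d)) (\<lambda>r c. A a $$ (r, c))"
      by (rule block_keeps[OF A[OF a] _ le]) (simp add: g2_def)
    have M2: "block d g2 (f 5) M" using M f by (auto simp: g2_def block_def)
    have "reaches subtract f2 g2 200 (Suc d ^ 2) (\<lambda>f' g'. keeps 17 f2 f' \<and> keeps (f2 5) g2 g' \<and>
        block d g' (f2 5) (\<lambda>r c. M r c - A a $$ (r, c)))"
      using f2 M2 A2 le f by (intro reaches_subtract) auto
    then have "reaches subtract f2 g2 200 ?X ?Q"
    proof (rule reaches_weaken)
      fix f' g' assume h: "keeps 17 f2 f' \<and> keeps (f2 5) g2 g' \<and>
        block d g' (f2 5) (\<lambda>r c. M r c - A a $$ (r, c))"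
      have "keeps 9 f f'" "f' 10 = f 10" "f' 11 = f 11" "f' 12 = a" "f' 13 = f 9 div (2 * m)"
        using h by (auto simp: keeps_def f2_def f1_def)
      moreover have "keeps (?B + 1) g g'" "g' (?B + 1) = - g (?B + 1)"
        using h f f2 by (auto simp: keeps_def g2_def)
      ultimately show "?Q f' g'"
        using h a f2 by (simp add: digit_elem_def digit_matrix_def)
    qed (use X in auto)
    then show "reaches (Seq (ISet (IConst 12) (reg 9))
         (Seq (RSet (scalar 1) (RSub (RConst 0) (RMem (scalar 1)))) subtract)) f1 g 250 ?X ?Q"
      using X
      by - (rule reaches_cost, rule reaches_Seq, rule reaches_ISet, rule reaches_Seq,
        rule reaches_RSet, auto simp: f2_def f1_def g2_def)
  next
    assume "\<not> holds (ILess (reg 9) (reg 1)) (f1, g)"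
    then have "\<not> a < m" using f by (simp add: f1_def)
    with X M f show "reaches (ISet (IConst 12) (ISub (reg 9) (reg 1))) f1 g 10 ?X ?Q"
      by - (rule reaches_cost, rule reaches_ISet,
        auto simp: f1_def digit_elem_def digit_matrix_def)
  qed (use X in auto)
  let ?R = "\<lambda>f' g'. keeps 9 f f' \<and> f' 11 = f 11 \<and> f' 12 = digit_elem m a \<and>
    f' 13 = f 9 div (2 * m) \<and> keeps (?B + 1) g g' \<and>
    g' (?B + 1) = digit_sign m (f 10) a (g (?B + 1)) \<and> block d g' (f 5) (digit_matrix m A a M)"
  have check: "reaches (If (ILess (reg 12) (reg 10)) (RSet (scalar 1) (RConst 0)) Skip) f' g'
      (5 + max 10 1) ?X ?R" if h: "?Q f' g'" for f' g'
  proof (rule reaches_cost[OF reaches_If])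
    have B: "f' 4 = ?B" using h by (auto simp: keeps_def)
    assume "holds (ILess (reg 12) (reg 10)) (f', g')"
    then have "digit_elem m a < f 10" using h by simp
    moreover have "block d (g'(?B + 1 := 0)) (f 5) (digit_matrix m A a M)"
      using h f by (auto simp: block_def)
    ultimately show "reaches (RSet (scalar 1) (RConst 0)) f' g' 10 ?X ?R"
      using h B X by - (rule reaches_cost, rule reaches_RSet, auto simp: digit_sign_def)
  next
    assume "\<not> holds (ILess (reg 12) (reg 10)) (f', g')"
    then have "\<not> digit_elem m a < f 10" using h by simp
    with h X show "reaches Skip f' g' 1 ?X ?R"
      by (intro reaches_Skip) (auto simp: digit_sign_def)
  qed (use X in auto)
  have last: "reaches (Seq (ISet (IConst 10) (IAdd (reg 12) (IConst 1))) (ISet (IConst 9) (reg 13)))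
      f' g' 20 ?X (\<lambda>f' g'. keeps 9 f f' \<and> f' 11 = f 11 \<and>
    f' 9 = f 9 div (2 * m) \<and> f' 10 = Suc (digit_elem m a) \<and> keeps (f 4 + 1) g g' \<and>
    g' (f 4 + 1) = digit_sign m (f 10) a (g (f 4 + 1)) \<and> block d g' (f 5) (digit_matrix m A a M))"
    if "?R f' g'" for f' g'
    using that X by - (rule reaches_cost, (rule reaches_Seq reaches_ISet)+, auto)
  show ?thesis
    unfolding digit_step_def
    by (rule reaches_cost, rule reaches_then[OF div], elim conjE, simp only:,
        rule reaches_then[OF branch], rule reaches_then[OF check], assumption, rule last) auto
qed

section \<open>The program for the coefficient\<close>

definition decode :: prog where
  "decode = Seq (ISet (IConst 9) (reg 8)) (Seq (ISet (IConst 10) (IConst 0))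
    (Seq (RSet (scalar 1) (RConst 1)) (Seq (clear 5) (For 11 (reg 2) digit_step))))"

definition term_step :: prog where
  "term_step = Seq decode (Seq char_coeff
    (RSet (scalar 0) (RAdd (RMem (scalar 0)) (RMul (RMem (scalar 1)) (RMem (scalar 2))))))"

lemma reaches_decode:
  fixes F :: "(nat \<Rightarrow> nat \<Rightarrow> real) \<Rightarrow> real"
  assumes f: "f 1 = m" "f 2 = k" "f 3 = d * d" "f 4 = m * (d * d)" "f 5 = f 4 + 4" "f 6 = 2 * m"
    and k: "k \<le> m" "k \<le> d" and n: "f 8 < n"
    and A: "\<And>i. i < m \<Longrightarrow> block d g (i * (d * d)) (\<lambda>r c. A i $$ (r, c))"
  shows "reaches decode f g 700 (n * Suc d ^ 3) (\<lambda>f' g'. keeps 9 f f' \<and> keeps (f 4 + 1) g g' \<and>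
    (\<exists>M. block d g' (f 5) M \<and>
      g' (f 4 + 1) * F M = code_term m A F k 0 1 (\<lambda>r c. 0) (f 8)))"
proof -
  let ?X = "n * Suc d ^ 3" and ?B = "f 4"
  have "0 < n" using n by simp
  have "n * Suc d ^ 2 * Suc d = ?X" by (simp only: power3_eq_cube power2_eq_square mult.assoc)
  moreover have "1 * Suc d ^ 2 \<le> ?X"
    using \<open>0 < n\<close> by (intro mult_le_mono power_increasing) auto
  ultimately have X: "0 < ?X" "n * Suc d ^ 2 * Suc d \<le> ?X" "Suc d ^ 2 \<le> ?X"
    using \<open>0 < n\<close> by simp_all
  define f1 where "f1 = f(9 := f 8, 10 := 0)"
  define g1 where "g1 = g(?B + 1 := 1)"
  have clear: "reaches (clear 5) f1 g1 50 ?X (\<lambda>f2 g2. keeps 17 f1 f2 \<and> keeps (f 5) g1 g2 \<and>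
      block d g2 (f 5) (\<lambda>r c. 0))"
    using reaches_time[OF reaches_clear[of 5 f1 d g1] _ X(3), of 50] f by (simp add: f1_def)
  let ?V = "code_term m A F k 0 1 (\<lambda>r c. 0) (f 8)"
  let ?I = "\<lambda>j f' g'. keeps 9 f f' \<and> f' 9 < n \<and> keeps (?B + 1) g g' \<and>
    (\<exists>M. block d g' (f 5) M \<and> code_term m A F (k - j) (f' 10) (g' (?B + 1)) M (f' 9) = ?V)"
  have loop: "reaches (For 11 (reg 2) digit_step) f2 g2 (500 + 2 * icost (reg 2) + 15)
      (n * Suc d ^ 2 * Suc d) (\<lambda>f' g'. keeps 9 f f' \<and> keeps (?B + 1) g g' \<and>
        (\<exists>M. block d g' (f 5) M \<and> g' (?B + 1) * F M = ?V))"
    if h: "keeps 17 f1 f2 \<and> keeps (f 5) g1 g2 \<and> block d g2 (f 5) (\<lambda>r c. 0)" for f2 g2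
  proof (rule reaches_For[where n = k and I = ?I])
    have "f2 9 = f 8" "f2 10 = 0" "keeps 9 f f2" using h by (auto simp: keeps_def f1_def)
    moreover have "keeps (?B + 1) g g2" "g2 (?B + 1) = 1"
      using h f by (auto simp: keeps_def g1_def)
    ultimately show "?I 0 (f2(11 := 0)) g2" using h n by auto
  next
    fix j f' g' assume j: "j < k" "?I j f' g'" "f' 11 = j"
    then obtain M where M: "block d g' (f 5) M"
      "code_term m A F (k - j) (f' 10) (g' (?B + 1)) M (f' 9) = ?V" by blast
    have eq: "f' 1 = m" "f' 2 = k" "f' 3 = d * d" "f' 4 = ?B" "f' 5 = f 5" "f' 6 = 2 * m"
      using j f by (auto simp: keeps_def)
    have A': "block d g' (i * (d * d)) (\<lambda>r c. A i $$ (r, c))" if "i < m" for i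
    proof (rule block_keeps[OF A[OF that]])
      show "keeps (?B + 1) g g'" using j by blast
      show "i * (d * d) + d * d \<le> ?B + 1"
        using mult_le_mono1[of "Suc i" m "d * d"] that f by simp
    qed
    define a where "a = f' 9 mod (2 * m)"
    have "0 < m" using j(1) k by simp
    have "reaches digit_step f' g' 500 (n * Suc d ^ 2) (\<lambda>f'' g''. keeps 9 f' f'' \<and>
        f'' 11 = f' 11 \<and> f'' 9 = f' 9 div (2 * m) \<and> f'' 10 = Suc (digit_elem m a) \<and>
        keeps (f' 4 + 1) g' g'' \<and> g'' (f' 4 + 1) = digit_sign m (f' 10) a (g' (f' 4 + 1)) \<and>
        block d g'' (f' 5) (digit_matrix m A a M))"
      unfolding a_def using eq f \<open>0 < m\<close> j M A' by (intro reaches_digit_step) auto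
    then show "reaches digit_step f' g' 500 (n * Suc d ^ 2)
        (\<lambda>f'' g''. f'' 11 = j \<and> ?I (Suc j) (f''(11 := Suc j)) g'')"
    proof (rule reaches_weaken)
      fix f'' g'' assume h: "keeps 9 f' f'' \<and>
        f'' 11 = f' 11 \<and> f'' 9 = f' 9 div (2 * m) \<and> f'' 10 = Suc (digit_elem m a) \<and>
        keeps (f' 4 + 1) g' g'' \<and> g'' (f' 4 + 1) = digit_sign m (f' 10) a (g' (f' 4 + 1)) \<and>
        block d g'' (f' 5) (digit_matrix m A a M)"
      have "k - j = Suc (k - Suc j)" using j(1) by simp
      with M(2) have "code_term m A F (k - Suc j) (Suc (digit_elem m a))
          (digit_sign m (f' 10) a (g' (?B + 1))) (digit_matrix m A a M) (f' 9 div (2 * m)) = ?V"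
        by (simp add: a_def Let_def)
      moreover have "keeps 9 f f''" "keeps (?B + 1) g g''"
        using h j eq by (auto simp: keeps_def)
      moreover have "f'' 9 < n"
        using h j(2) div_le_dividend[of "f' 9" "2 * m"] by linarith
      ultimately show "f'' 11 = j \<and> ?I (Suc j) (f''(11 := Suc j)) g''"
        using h eq j(3) by auto
    qed auto
  qed (use f k \<open>0 < n\<close> in \<open>auto simp: keeps_def\<close>)
  have rest: "reaches (Seq (clear 5) (For 11 (reg 2) digit_step)) f1 g1 600 ?X
      (\<lambda>f' g'. keeps 9 f f' \<and> keeps (?B + 1) g g' \<and>
        (\<exists>M. block d g' (f 5) M \<and> g' (?B + 1) * F M = ?V))"
    by (rule reaches_cost, rule reaches_then[OF clear], rule reaches_time[OF loop _ X(2)]) auto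
  show ?thesis
    unfolding decode_def
    by (rule reaches_cost, rule reaches_Seq, rule reaches_ISet, rule reaches_Seq, rule reaches_ISet,
        rule reaches_Seq, rule reaches_RSet)
      (use rest X in \<open>auto simp: f1_def g1_def\<close>)
qed

lemma reaches_term_step:
  assumes f: "f 0 = d" "f 1 = m" "f 2 = k" "f 3 = d * d" "f 4 = m * (d * d)" "f 5 = f 4 + 4"
      "f 6 = 2 * m"
    and k: "k \<le> m" "k \<le> d" and n: "f 8 < n"
    and A: "\<And>i. i < m \<Longrightarrow> block d g (i * (d * d)) (\<lambda>r c. A i $$ (r, c))"
  shows "reaches term_step f g 2000 (n * Suc d ^ 4) (\<lambda>f' g'. keeps 9 f f' \<and>
    g' (f 4) = g (f 4) + code_term m A (\<lambda>M. fl_coeff d M k) k 0 1 (\<lambda>r c. 0) (f 8) \<and>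
    keeps (f 4) g g')"
proof -
  let ?X = "n * Suc d ^ 4" and ?B = "f 4"
  let ?V = "code_term m A (\<lambda>M. fl_coeff d M k) k 0 1 (\<lambda>r c. 0) (f 8)"
  have "0 < n" using n by simp
  moreover have "n * Suc d ^ 3 \<le> n * Suc d ^ 4"
    by (intro mult_le_mono2 power_increasing) auto
  ultimately have X: "n * Suc d ^ 3 \<le> ?X" "Suc d ^ 4 \<le> ?X" "0 < ?X" by simp_all
  have dec: "reaches decode f g 700 ?X (\<lambda>f' g'. keeps 9 f f' \<and> keeps (?B + 1) g g' \<and>
    (\<exists>M. block d g' (f 5) M \<and> g' (?B + 1) * fl_coeff d M k = ?V))"
    using assms by (intro reaches_time[OF reaches_decode _ X(1)]) auto
  have "reaches (Seq char_coeff
      (RSet (scalar 0) (RAdd (RMem (scalar 0)) (RMul (RMem (scalar 1)) (RMem (scalar 2))))))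
      f1 g1 1100 ?X (\<lambda>f' g'. keeps 9 f f' \<and> g' ?B = g ?B + ?V \<and> keeps ?B g g')"
    if h: "keeps 9 f f1 \<and> keeps (?B + 1) g g1 \<and>
      block d g1 (f 5) M \<and> g1 (?B + 1) * fl_coeff d M k = ?V" for f1 g1 M
  proof (rule reaches_cost, rule reaches_then)
    have M: "block d g1 (f 5) M" "g1 (?B + 1) * fl_coeff d M k = ?V" using h by auto
    have eq: "f1 0 = d" "f1 2 = k" "f1 3 = d * d" "f1 4 = ?B" "f1 5 = f 5"
      using h f by (auto simp: keeps_def)
    show "reaches char_coeff f1 g1 1000 ?X (\<lambda>f' g'. keeps 14 f1 f' \<and>
        keeps (f1 4 + 2) g1 g' \<and> g' (f1 4 + 2) = fl_coeff d M k)"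
      using eq f k M by (intro reaches_time[OF reaches_char_coeff _ X(2)]) auto
    fix f2 g2 assume h2: "keeps 14 f1 f2 \<and> keeps (f1 4 + 2) g1 g2 \<and> g2 (f1 4 + 2) = fl_coeff d M k"
    have "f2 4 = ?B" "keeps 9 f f2" using h h2 eq by (auto simp: keeps_def)
    moreover have "g2 ?B = g ?B" "g2 (?B + 1) = g1 (?B + 1)" "keeps ?B g g2"
      using h h2 eq by (auto simp: keeps_def)
    ultimately show "reaches
        (RSet (scalar 0) (RAdd (RMem (scalar 0)) (RMul (RMem (scalar 1)) (RMem (scalar 2)))))
        f2 g2 50 ?X (\<lambda>f' g'. keeps 9 f f' \<and> g' ?B = g ?B + ?V \<and> keeps ?B g g')"
      using h2 eq M(2) X by - (rule reaches_cost, rule reaches_RSet, auto)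
  qed simp
  then show ?thesis
    unfolding term_step_def by - (rule reaches_cost, rule reaches_then[OF dec], auto)
qed

definition init_regs :: prog where
  "init_regs = Seq (ISet (IConst 3) (IConst 0))
    (Seq (For 17 (reg 0) (ISet (IConst 3) (IAdd (reg 3) (reg 0))))
    (Seq (ISet (IConst 4) (IConst 0))
    (Seq (For 17 (reg 3) (ISet (IConst 4) (IAdd (reg 4) (reg 1))))
    (Seq (ISet (IConst 5) (IAdd (reg 4) (IConst 4)))
    (Seq (ISet (IConst 6) (IAdd (reg 1) (reg 1)))
    (Seq (ISet (IConst 7) (IConst 1))
      (For 16 (reg 2) (Seq (ISet (IConst 18) (IConst 0))
        (Seq (For 17 (reg 6) (ISet (IConst 18) (IAdd (reg 18) (reg 7))))
          (ISet (IConst 7) (reg 18)))))))))))"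

lemma reaches_init_regs:
  assumes f: "f 0 = d" "f 1 = m" "f 2 = k" and k: "k \<le> m" "k \<le> d"
  shows "reaches init_regs f g 500 (Suc ((2 * m) ^ k) * Suc d ^ 2) (\<lambda>f' g'. keeps 3 f f' \<and> g' = g \<and>
    f' 3 = d * d \<and> f' 4 = m * (d * d) \<and> f' 5 = f' 4 + 4 \<and> f' 6 = 2 * m \<and> f' 7 = (2 * m) ^ k)"
proof -
  let ?N = "(2 * m) ^ k"
  let ?X = "Suc ?N * Suc d ^ 2"
  have X: "1 * Suc d \<le> ?X" "1 * Suc d ^ 2 \<le> ?X" "Suc ?N * Suc d \<le> ?X" "0 < ?X"
    by (rule mult_le_mono; simp add: self_le_power)+ simp
  let ?Q1 = "\<lambda>f' g'. keeps 3 f f' \<and> g' = g \<and> f' 3 = d * d"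
  have 1: "reaches (For 17 (reg 0) (ISet (IConst 3) (IAdd (reg 3) (reg 0)))) (f(3 := 0)) g 50 ?X ?Q1"
  proof (rule reaches_time)
    show "reaches (For 17 (reg 0) (ISet (IConst 3) (IAdd (reg 3) (reg 0)))) (f(3 := 0)) g
        (10 + 2 * icost (reg 0) + 15) (1 * Suc d) ?Q1"
    proof (rule reaches_For[where n = d and
          I = "\<lambda>i f' g'. keeps 3 f f' \<and> g' = g \<and> f' 3 = i * d"])
      fix i f' g' assume "keeps 3 f f' \<and> g' = g \<and> f' 3 = i * d" "f' 17 = i"
      with f show "reaches (ISet (IConst 3) (IAdd (reg 3) (reg 0))) f' g' 10 1 (\<lambda>f' g'. f' 17 = i \<and>
          keeps 3 f (f'(17 := Suc i)) \<and> g' = g \<and> (f'(17 := Suc i)) 3 = Suc i * d)"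
        by - (rule reaches_cost, rule reaches_ISet, auto simp: keeps_def)
    qed (use f in \<open>auto simp: keeps_def\<close>)
  qed (use X in auto)
  let ?Q2 = "\<lambda>f' g'. keeps 3 f f' \<and> g' = g \<and> f' 3 = d * d \<and> f' 4 = m * (d * d)"
  have 2: "reaches (For 17 (reg 3) (ISet (IConst 4) (IAdd (reg 4) (reg 1)))) (f1(4 := 0)) g1 50 ?X ?Q2"
    if h: "?Q1 f1 g1" for f1 g1
  proof (rule reaches_time)
    show "reaches (For 17 (reg 3) (ISet (IConst 4) (IAdd (reg 4) (reg 1)))) (f1(4 := 0)) g1
        (10 + 2 * icost (reg 3) + 15) (1 * Suc d ^ 2) ?Q2"
    proof (rule reaches_For[where n = "d * d" and
          I = "\<lambda>i f' g'. keeps 3 f f' \<and> g' = g \<and> f' 3 = d * d \<and> f' 4 = m * i"])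
      fix i f' g' assume "keeps 3 f f' \<and> g' = g \<and> f' 3 = d * d \<and> f' 4 = m * i" "f' 17 = i"
      with f show "reaches (ISet (IConst 4) (IAdd (reg 4) (reg 1))) f' g' 10 1 (\<lambda>f' g'. f' 17 = i \<and>
          keeps 3 f (f'(17 := Suc i)) \<and> g' = g \<and> (f'(17 := Suc i)) 3 = d * d \<and>
          (f'(17 := Suc i)) 4 = m * Suc i)"
        by - (rule reaches_cost, rule reaches_ISet, auto simp: keeps_def)
    qed (use f h in \<open>auto simp: keeps_def power2_eq_square\<close>)
  qed (use X in auto)
  let ?J = "\<lambda>f' g'. keeps 3 f f' \<and> g' = g \<and> f' 3 = d * d \<and> f' 4 = m * (d * d) \<and>
    f' 5 = f' 4 + 4 \<and> f' 6 = 2 * m"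
  let ?body = "Seq (ISet (IConst 18) (IConst 0))
        (Seq (For 17 (reg 6) (ISet (IConst 18) (IAdd (reg 18) (reg 7))))
          (ISet (IConst 7) (reg 18)))"
  have body: "reaches ?body f1 g1 100 (Suc ?N) (\<lambda>f' g'. ?J f' g' \<and> f' 16 = f1 16 \<and> f' 7 = 2 * m * f1 7)"
    if h: "?J f1 g1" and "0 < k" for f1 g1
  proof -
    have "2 * m \<le> ?N" using k \<open>0 < k\<close> by (intro self_le_power) auto
    have "reaches (For 17 (reg 6) (ISet (IConst 18) (IAdd (reg 18) (reg 7)))) (f1(18 := 0)) g1
        (10 + 2 * icost (reg 6) + 15) (1 * Suc ?N) (\<lambda>f' g'. keeps 17 f1 f' \<and> g' = g1 \<and>
          f' 18 = 2 * m * f1 7)"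
    proof (rule reaches_For[where n = "2 * m" and
          I = "\<lambda>i f' g'. keeps 17 f1 f' \<and> g' = g1 \<and> f' 18 = i * f1 7"])
      fix i f' g' assume "keeps 17 f1 f' \<and> g' = g1 \<and> f' 18 = i * f1 7" "f' 17 = i"
      then show "reaches (ISet (IConst 18) (IAdd (reg 18) (reg 7))) f' g' 10 1 (\<lambda>f' g'. f' 17 = i \<and>
          keeps 17 f1 (f'(17 := Suc i)) \<and> g' = g1 \<and> (f'(17 := Suc i)) 18 = Suc i * f1 7)"
        by - (rule reaches_cost, rule reaches_ISet, auto simp: keeps_def)
    qed (use h \<open>2 * m \<le> ?N\<close> in \<open>auto simp: keeps_def\<close>)
    then have *: "reaches (For 17 (reg 6) (ISet (IConst 18) (IAdd (reg 18) (reg 7)))) (f1(18 := 0)) g1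
        50 (Suc ?N) (\<lambda>f' g'. keeps 17 f1 f' \<and> g' = g1 \<and> f' 18 = 2 * m * f1 7)"
      by (rule reaches_time) auto
    have "reaches (ISet (IConst 7) (reg 18)) f2 g2 10 (Suc ?N)
        (\<lambda>f' g'. ?J f' g' \<and> f' 16 = f1 16 \<and> f' 7 = 2 * m * f1 7)"
      if "keeps 17 f1 f2 \<and> g2 = g1 \<and> f2 18 = 2 * m * f1 7" for f2 g2
      using that h by - (rule reaches_cost, rule reaches_ISet, auto simp: keeps_def)
    from reaches_then[OF * this] show ?thesis
      by - (rule reaches_cost, rule reaches_Seq, rule reaches_ISet, auto)
  qed
  have 3: "reaches (For 16 (reg 2) ?body) (f2(5 := f2 4 + 4, 6 := m + m, 7 := 1)) g2 150 ?X
      (\<lambda>f' g'. ?J f' g' \<and> f' 7 = ?N)" if h: "?Q2 f2 g2" for f2 g2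
  proof (rule reaches_time)
    show "reaches (For 16 (reg 2) ?body) (f2(5 := f2 4 + 4, 6 := m + m, 7 := 1)) g2
      (100 + 2 * icost (reg 2) + 15) (Suc ?N * Suc d) (\<lambda>f' g'. ?J f' g' \<and> f' 7 = ?N)"
    proof (rule reaches_For[where n = k and I = "\<lambda>j f' g'. ?J f' g' \<and> f' 7 = (2 * m) ^ j"])
      fix j f' g' assume j: "j < k" "?J f' g' \<and> f' 7 = (2 * m) ^ j" "f' 16 = j"
      have "reaches ?body f' g' 100 (Suc ?N) (\<lambda>f'' g''. ?J f'' g'' \<and> f'' 16 = f' 16 \<and> f'' 7 = 2 * m * f' 7)"
        using j by (intro body) auto
      then show "reaches ?body f' g' 100 (Suc ?N) (\<lambda>f'' g''. f'' 16 = j \<and> ?J (f''(16 := Suc j)) g'' \<and>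
          (f''(16 := Suc j)) 7 = (2 * m) ^ Suc j)"
        by (rule reaches_weaken) (use j in auto)
    qed (use h f k in \<open>auto simp: keeps_def\<close>)
  qed (use X in auto)
  have rest2: "reaches (Seq (ISet (IConst 5) (IAdd (reg 4) (IConst 4)))
    (Seq (ISet (IConst 6) (IAdd (reg 1) (reg 1))) (Seq (ISet (IConst 7) (IConst 1))
      (For 16 (reg 2) ?body)))) f2 g2 200 ?X (\<lambda>f' g'. ?J f' g' \<and> f' 7 = ?N)" if h: "?Q2 f2 g2" for f2 g2
  proof -
    have "f2 1 = m" using h f by (auto simp: keeps_def)
    with 3[OF h] X(4) show ?thesis
      by - (rule reaches_cost, rule reaches_Seq, rule reaches_ISet, rule reaches_Seq,
        rule reaches_ISet, rule reaches_Seq, rule reaches_ISet, auto)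
  qed
  have rest1: "reaches (Seq (ISet (IConst 4) (IConst 0))
    (Seq (For 17 (reg 3) (ISet (IConst 4) (IAdd (reg 4) (reg 1))))
    (Seq (ISet (IConst 5) (IAdd (reg 4) (IConst 4)))
    (Seq (ISet (IConst 6) (IAdd (reg 1) (reg 1))) (Seq (ISet (IConst 7) (IConst 1))
      (For 16 (reg 2) ?body)))))) f1 g1 300 ?X (\<lambda>f' g'. ?J f' g' \<and> f' 7 = ?N)" if h: "?Q1 f1 g1" for f1 g1
    using reaches_then[OF 2[OF h] rest2] X(4)
    by - (rule reaches_cost, rule reaches_Seq, rule reaches_ISet, auto)
  have "reaches init_regs f g 500 ?X (\<lambda>f' g'. ?J f' g' \<and> f' 7 = ?N)"
    unfolding init_regs_def
    by (rule reaches_cost, rule reaches_Seq, rule reaches_ISet)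
      (use reaches_then[OF 1 rest1] X(4) in auto)
  then show ?thesis by (rule reaches_weaken) auto
qed

definition mixed_coeff_prog :: prog where
  "mixed_coeff_prog = If (ILess (reg 1) (reg 2)) (RSet (IConst 0) (RConst 0))
    (Seq init_regs (Seq (RSet (scalar 0) (RConst 0)) (Seq (For 8 (reg 7) term_step)
      (RSet (IConst 0) (RMem (scalar 0))))))"

lemma block_input_mem:
  assumes "i < m"
  shows "block d (snd (input_mem d m k A)) (i * (d * d)) (\<lambda>r c. A i $$ (r, c))"
  unfolding block_def
proof (intro allI impI)
  fix r c assume rc: "r < d" "c < d"
  let ?a = "i * (d * d) + (r * d + c)"
  have lt: "r * d + c < d * d" using row_major_less[OF rc] .
  have "?a < m * (d * d)" using row_major_less[OF assms lt] .
  moreover have div: "?a div (d * d) = i"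
    using lt by (intro div_nat_eqI) (simp_all add: algebra_simps)
  moreover have "?a mod (d * d) = r * d + c"
    unfolding modulo_nat_def div by simp
  moreover have "?a mod d = c"
    using rc mod_mult_self3[of "i * d + r" d c] by (simp add: algebra_simps)
  moreover have "(r * d + c) div d = r" using rc by auto
  ultimately have "snd (input_mem d m k A) ?a = A i $$ (r, c)"
    by (simp add: input_mem_def)
  then show "snd (input_mem d m k A) (i * (d * d) + r * d + c) = A i $$ (r, c)"
    by (simp add: add.assoc)
qed

lemma reaches_mixed_coeff_prog:
  fixes A :: "nat \<Rightarrow> real mat" and d m k :: nat
  defines "s \<equiv> input_mem d m k A"
  assumes k: "k \<le> m" "k \<le> d"
  shows "reaches mixed_coeff_prog (fst s) (snd s) 5000 (Suc ((2 * m) ^ k) ^ 2 * Suc d ^ 4)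
    (\<lambda>f' g'. g' 0 = coeff (mixed_charpoly d m A) (d - k))"
proof -
  let ?N = "(2 * m) ^ k"
  let ?X = "Suc ?N ^ 2 * Suc d ^ 4"
  let ?B = "m * (d * d)"
  let ?V = "code_term m A (\<lambda>M. fl_coeff d M k) k 0 1 (\<lambda>r c. 0)"
  let ?J = "\<lambda>(f :: nat \<Rightarrow> nat) g. f 0 = d \<and> f 1 = m \<and> f 2 = k \<and> f 3 = d * d \<and> f 4 = ?B \<and>
    f 5 = ?B + 4 \<and> f 6 = 2 * m \<and> f 7 = ?N \<and> keeps ?B (snd s) g"
  have X: "Suc ?N * Suc d ^ 2 \<le> ?X" "Suc ?N * Suc d ^ 4 * Suc ?N \<le> ?X" "0 < ?X"
  proof -
    show "Suc ?N * Suc d ^ 2 \<le> ?X"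
      by (intro mult_le_mono power_increasing self_le_power) auto
    have "Suc ?N * Suc d ^ 4 * Suc ?N = ?X"
      unfolding power2_eq_square[of "Suc ?N"] by (simp only: mult_ac)
    then show "Suc ?N * Suc d ^ 4 * Suc ?N \<le> ?X" by (rule eq_refl)
  qed simp
  have s: "fst s 0 = d" "fst s 1 = m" "fst s 2 = k" by (simp_all add: s_def input_mem_def)
  have init: "reaches init_regs (fst s) (snd s) 500 ?X ?J"
    by (rule reaches_weaken[OF reaches_init_regs[OF s k] _ X(1)]) (use s in \<open>auto simp: keeps_def\<close>)
  have loop: "reaches (For 8 (reg 7) term_step) f g (2000 + 2 * icost (reg 7) + 15)
      (Suc ?N * Suc d ^ 4 * Suc ?N) (\<lambda>f' g'. ?J f' g' \<and> g' ?B = (\<Sum>q<?N. ?V q))"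
    if h: "?J f g" "g ?B = 0" for f g
  proof (rule reaches_For[where n = ?N and I = "\<lambda>n f' g'. ?J f' g' \<and> g' ?B = (\<Sum>q<n. ?V q)"])
    fix n f' g' assume n: "n < ?N" "?J f' g' \<and> g' ?B = (\<Sum>q<n. ?V q)" "f' 8 = n"
    have A: "block d g' (i * (d * d)) (\<lambda>r c. A i $$ (r, c))" if "i < m" for i
    proof (rule block_keeps[OF block_input_mem[OF that, of d k A, folded s_def]])
      show "keeps ?B (snd s) g'" using n by blast
      show "i * (d * d) + d * d \<le> ?B"
        using mult_le_mono1[of "Suc i" m "d * d"] that by simp
    qed
    have "reaches term_step f' g' 2000 (Suc ?N * Suc d ^ 4) (\<lambda>f'' g''. keeps 9 f' f'' \<and>
        g'' (f' 4) = g' (f' 4) + ?V (f' 8) \<and> keeps (f' 4) g' g'')"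
      using n k A by (intro reaches_term_step) auto
    then show "reaches term_step f' g' 2000 (Suc ?N * Suc d ^ 4) (\<lambda>f'' g''. f'' 8 = n \<and>
        ?J (f''(8 := Suc n)) g'' \<and> g'' ?B = (\<Sum>q<Suc n. ?V q))"
      by (rule reaches_weaken) (use n in \<open>auto simp: keeps_def\<close>)
  qed (use h in auto)
  have rest: "reaches (Seq (RSet (scalar 0) (RConst 0)) (Seq (For 8 (reg 7) term_step)
      (RSet (IConst 0) (RMem (scalar 0))))) f g 3000 ?X (\<lambda>f' g'. g' 0 = (\<Sum>q<?N. ?V q))"
    if h: "?J f g" for f g
  proof (rule reaches_cost, rule reaches_Seq, rule reaches_RSet, rule reaches_then)
    have "reaches (For 8 (reg 7) term_step) f (g(?B := 0)) 2050 ?X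
        (\<lambda>f' g'. ?J f' g' \<and> g' ?B = (\<Sum>q<?N. ?V q))"
      by (rule reaches_time[OF loop _ X(2)]) (use h in auto)
    then show "reaches (For 8 (reg 7) term_step) f
        (g(ival (scalar 0) (f, g) := rval (RConst 0) (f, g))) 2050 ?X
        (\<lambda>f' g'. ?J f' g' \<and> g' ?B = (\<Sum>q<?N. ?V q))"
      using h by simp
    fix f' g' assume "?J f' g' \<and> g' ?B = (\<Sum>q<?N. ?V q)"
    with X show "reaches (RSet (IConst 0) (RMem (scalar 0))) f' g' 10 ?X
        (\<lambda>f' g'. g' 0 = (\<Sum>q<?N. ?V q))"
      by - (rule reaches_cost, rule reaches_RSet, auto)
  qed (use X in auto)
  have "reaches mixed_coeff_prog (fst s) (snd s) (5 + max 5 (500 + 3000)) ?X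
      (\<lambda>f' g'. g' 0 = (\<Sum>q<?N. ?V q))"
    unfolding mixed_coeff_prog_def
    by (rule reaches_cost, rule reaches_If[where K = 5], use s k in simp,
        rule reaches_then[OF init rest], assumption) (use X in auto)
  then show ?thesis
    by (rule reaches_weaken) (auto simp: coeff_mixed_charpoly_sum[OF k(2)])
qed

lemma double_power_le:
  assumes "k \<le> m"
  shows "(2 * m) ^ k \<le> 2 * (m ^ k) ^ (2 :: nat)"
proof (cases "m \<le> 1")
  case True
  with assms have "k = 0 \<or> k = 1 \<and> m = 1" by auto
  then show ?thesis by auto
next
  case False
  then have "2 ^ k \<le> m ^ k" by (intro power_mono) auto
  then have "2 ^ k * m ^ k \<le> m ^ k * m ^ k" by (rule mult_le_mono1)
  also have "2 ^ k * m ^ k = (2 * m) ^ k" by (rule power_mult_distrib[symmetric])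
  finally show ?thesis unfolding power2_eq_square by linarith
qed

theorem theorem5p1:
  shows "\<exists>(P :: prog) (p :: nat poly) (q :: nat poly).
    \<forall>(d :: nat) (m :: nat) (k :: nat) (A :: nat \<Rightarrow> real mat).
      k \<le> d \<longrightarrow> (\<forall>i<m. psd_mat d (A i)) \<longrightarrow>
      (\<exists>t s. runs P (input_mem d m k A) t s \<and>
             machine_output s = coeff (mixed_charpoly d m A) (d - k) \<and>
             t \<le> poly p (m ^ k) * poly q d)"
proof (rule exI[of _ mixed_coeff_prog], rule exI[of _ "[:5000:] * [:1, 0, 2:] ^ 2"],
    rule exI[of _ "[:1, 1:] ^ 4"], intro allI impI)
  fix d m k :: nat and A :: "nat \<Rightarrow> real mat"
  assume kd: "k \<le> d"
  let ?s = "input_mem d m k A"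
  let ?Y = "Suc (2 * (m ^ k) ^ 2) ^ 2 * Suc d ^ 4"
  have "reaches mixed_coeff_prog (fst ?s) (snd ?s) 5000 ?Y
      (\<lambda>f g. g 0 = coeff (mixed_charpoly d m A) (d - k))"
  proof (cases "k \<le> m")
    case True
    show ?thesis
      by (rule reaches_time[OF reaches_mixed_coeff_prog[OF True kd] order.refl])
        (intro mult_le_mono1 power_mono Suc_leI le_imp_less_Suc double_power_le True, simp)
  next
    case False
    then show ?thesis
      unfolding mixed_coeff_prog_def
      by - (rule reaches_cost, rule reaches_If[where K = 10 and L = 0], rule reaches_cost,
        rule reaches_RSet, auto simp: coeff_mixed_charpoly_eq_0[OF kd] input_mem_def)
  qed
  then obtain t f g where t: "runs mixed_coeff_prog ?s t (f, g)" "t \<le> 5000 * ?Y"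
      "g 0 = coeff (mixed_charpoly d m A) (d - k)"
    by (auto simp: reaches_def)
  have "poly [:1, 0, 2:] x = Suc (2 * x ^ 2)" for x :: nat by (simp add: power2_eq_square)
  then have "poly ([:5000:] * [:1, 0, 2:] ^ 2) (m ^ k) * poly ([:1, 1:] ^ 4) d = 5000 * ?Y"
    by (simp only: poly_mult poly_power) simp
  with t(2) have "t \<le> poly ([:5000:] * [:1, 0, 2:] ^ 2) (m ^ k) * poly ([:1, 1:] ^ 4) d"
    by (simp only:)
  with t(1,3) show "\<exists>t s. runs mixed_coeff_prog ?s t s \<and>
      machine_output s = coeff (mixed_charpoly d m A) (d - k) \<and>
      t \<le> poly ([:5000:] * [:1, 0, 2:] ^ 2) (m ^ k) * poly ([:1, 1:] ^ 4) d"
    by (intro exI[of _ t] exI[of _ "(f, g)"] conjI) (simp_all only: machine_output_def snd_conv)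
qed

end
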